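(* The group $\mathrm{Pin}^+(n)$ is natural for every integer $n \geq 1$. For an integer $n \ge 1$, the group $\mathrm{Pin}^-(n)$ is natural if and only if $n \geq 3$.
   Context: A group $(G,* )$ is called natural if there exists a metric $d$ on the underlying set $G$ such that (i) every right translation $R_g: x \mapsto x*g$, $g \in G$, is an isometry of $(G,d)$, and (ii) whenever $(G,\circ)$ is any group structure on the same set $G$ all of whose right translations are isometries of $(G,d)$, then $(G,\circ)$ is isomorphic to $(G,* )$ as an abstract group. The metric $d$ is not required to induce the Lie group topology. $\mathrm{Pin}^{\pm}(n)$ denotes the double cover of $O(n)$ given by the subgroup generated by the unit vectors $v \in \mathbb{R}^n$ in the units of the real Clifford algebra of $\mathbb{R}^n$ with the convention $v^2 = \pm |v|^2$ (the same sign as in $\mathrm{Pin}^\pm$). Thus $\mathrm{Pin}^+(1) \cong C_2 \times C_2$, $\mathrm{Pin}^-(1) \cong C_4$, $\mathrm{Pin}^+(2) \cong O(2)$, and $\mathrm{Pin}^-(2) = S^1 \cup jS^1 \subset SU(2)$ (unit quaternions), where $S^1$ is the group of unit complex numbers. *)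

theory Defs
  imports "HOL-Analysis.Analysis" "HOL-Algebra.QuotRing" "HOL-Algebra.Generated_Groups"
begin

section \<open>Natural groups\<close>

definition isometry_of :: "'a set \<Rightarrow> ('a \<Rightarrow> 'a \<Rightarrow> real) \<Rightarrow> ('a \<Rightarrow> 'a) \<Rightarrow> bool" where
  "isometry_of M d f \<longleftrightarrow> bij_betw f M M \<and> (\<forall>x\<in>M. \<forall>y\<in>M. d (f x) (f y) = d x y)"

definition right_invariant :: "('a, 'b) monoid_scheme \<Rightarrow> ('a \<Rightarrow> 'a \<Rightarrow> real) \<Rightarrow> bool" where
  "right_invariant G d \<longleftrightarrow>
     (\<forall>g\<in>carrier G. isometry_of (carrier G) d (\<lambda>x. x \<otimes>\<^bsub>G\<^esub> g))"

definition natural_group :: "('a, 'b) monoid_scheme \<Rightarrow> bool" where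
  "natural_group G \<longleftrightarrow>
     group G \<and>
     (\<exists>d. Metric_space (carrier G) d \<and> right_invariant G d \<and>
        (\<forall>H :: 'a monoid.
           group H \<and> carrier H = carrier G \<and> right_invariant H d \<longrightarrow> H \<cong> G))"


section \<open>The real Clifford algebras of Euclidean space\<close>

text \<open>
  The tensor algebra of \<open>\<real>\<^sup>n\<close>, where \<open>n\<close> is the number of elements of the index type, consists
  of the finitely supported functions on words over the index type: the word \<open>[i\<^sub>1, \<dots>, i\<^sub>k]\<close>
  stands for the basis tensor \<open>e\<^bsub>i\<^sub>1\<^esub> \<otimes> \<dots> \<otimes> e\<^bsub>i\<^sub>k\<^esub>\<close>. Its product is bilinear and concatenates
  words, so the coefficient of a product at \<open>w\<close> is a sum over all ways of splitting \<open>w\<close> in two.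
\<close>

definition tensor_algebra :: "('n list \<Rightarrow> real) ring" where
  "tensor_algebra =
     \<lparr>carrier = {f. finite {w. f w \<noteq> 0}},
      mult = (\<lambda>f g w. \<Sum>k\<le>length w. f (take k w) * g (drop k w)),
      one = (\<lambda>w. if w = [] then 1 else 0),
      zero = (\<lambda>w. 0),
      add = (\<lambda>f g w. f w + g w)\<rparr>"

definition tensor_scalar :: "real \<Rightarrow> 'n list \<Rightarrow> real" where
  "tensor_scalar c = (\<lambda>w. if w = [] then c else 0)"

definition tensor_vec :: "real ^ 'n \<Rightarrow> 'n list \<Rightarrow> real" where
  "tensor_vec v = (\<lambda>w. case w of [i] \<Rightarrow> v $ i | _ \<Rightarrow> 0)"

text \<open>
  The sign convention is \<open>v\<^sup>2 = \<epsilon> |v|\<^sup>2\<close>; only \<open>\<epsilon> = 1\<close> and \<open>\<epsilon> = -1\<close> are used below. The ring ideal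
  generated by the relations is closed under real scalars, because these belong to the ring.
\<close>

definition clifford_ideal :: "real \<Rightarrow> ('n::finite list \<Rightarrow> real) set" where
  "clifford_ideal \<epsilon> =
     Idl\<^bsub>tensor_algebra\<^esub>
       {tensor_vec v \<otimes>\<^bsub>tensor_algebra\<^esub> tensor_vec v
          \<ominus>\<^bsub>tensor_algebra\<^esub> tensor_scalar (\<epsilon> * (norm v)\<^sup>2) | v :: real ^ 'n. True}"

definition clifford_algebra :: "real \<Rightarrow> ('n::finite list \<Rightarrow> real) set ring" where
  "clifford_algebra \<epsilon> = tensor_algebra Quot clifford_ideal \<epsilon>"

definition clifford_vec :: "real \<Rightarrow> real ^ 'n::finite \<Rightarrow> ('n list \<Rightarrow> real) set" where
  "clifford_vec \<epsilon> v = clifford_ideal \<epsilon> +>\<^bsub>tensor_algebra\<^esub> tensor_vec v"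


section \<open>The Pin groups\<close>

definition pin_group :: "real \<Rightarrow> ('n::finite list \<Rightarrow> real) set monoid" where
  "pin_group \<epsilon> =
     (units_of (clifford_algebra \<epsilon>))
       \<lparr>carrier := generate (units_of (clifford_algebra \<epsilon>))
                     {clifford_vec \<epsilon> v | v :: real ^ 'n. norm v = 1}\<rparr>"

definition Pin_plus :: "'n::finite itself \<Rightarrow> ('n list \<Rightarrow> real) set monoid" where
  "Pin_plus _ = pin_group 1"

definition Pin_minus :: "'n::finite itself \<Rightarrow> ('n list \<Rightarrow> real) set monoid" where
  "Pin_minus _ = pin_group (- 1)"


section \<open>Well-definedness\<close>

lemma tensor_algebra_simps:
  "carrier tensor_algebra = {f. finite {w. f w \<noteq> 0}}"
  "f \<otimes>\<^bsub>tensor_algebra\<^esub> g = (\<lambda>w. \<Sum>k\<le>length w. f (take k w) * g (drop k w))"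
  "\<one>\<^bsub>tensor_algebra\<^esub> = (\<lambda>w. if w = [] then 1 else 0)"
  "\<zero>\<^bsub>tensor_algebra\<^esub> = (\<lambda>w. 0)"
  "f \<oplus>\<^bsub>tensor_algebra\<^esub> g = (\<lambda>w. f w + g w)"
  by (simp_all add: tensor_algebra_def)

lemma tensor_mult_closed:
  fixes f g :: "'n list \<Rightarrow> real"
  assumes "finite {w. f w \<noteq> 0}" "finite {w. g w \<noteq> 0}"
  shows "finite {w. (\<Sum>k\<le>length w. f (take k w) * g (drop k w)) \<noteq> 0}"
proof (rule finite_subset)
  show "{w. (\<Sum>k\<le>length w. f (take k w) * g (drop k w)) \<noteq> 0}
          \<subseteq> (\<lambda>(u, v). u @ v) ` ({w. f w \<noteq> 0} \<times> {w. g w \<noteq> 0})"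
  proof
    fix w assume "w \<in> {w. (\<Sum>k\<le>length w. f (take k w) * g (drop k w)) \<noteq> 0}"
    then obtain k where "f (take k w) * g (drop k w) \<noteq> 0"
      by (auto elim: sum.not_neutral_contains_not_neutral)
    then show "w \<in> (\<lambda>(u, v). u @ v) ` ({w. f w \<noteq> 0} \<times> {w. g w \<noteq> 0})"
      by (intro image_eqI[where x = "(take k w, drop k w)"]) auto
  qed
qed (use assms in auto)

lemma tensor_mult_assoc:
  fixes f g h :: "'n list \<Rightarrow> real"
  shows "(f \<otimes>\<^bsub>tensor_algebra\<^esub> g) \<otimes>\<^bsub>tensor_algebra\<^esub> h
       = f \<otimes>\<^bsub>tensor_algebra\<^esub> (g \<otimes>\<^bsub>tensor_algebra\<^esub> h)"
proof
  fix w :: "'n list"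
  let ?n = "length w"
  let ?F = "\<lambda>j k. f (take j w) * g (take k (drop j w)) * h (drop (j + k) w)"
  have "((f \<otimes>\<^bsub>tensor_algebra\<^esub> g) \<otimes>\<^bsub>tensor_algebra\<^esub> h) w
      = (\<Sum>k\<le>?n. \<Sum>j\<le>k. ?F j (k - j))"
    by (auto simp: tensor_algebra_simps sum_distrib_right min_def drop_take
        intro!: sum.cong)
  also have "\<dots> = (\<Sum>(j, k)\<in>{(j, k). j + k \<le> ?n}. ?F j k)"
    by (rule sum.triangle_reindex_eq [symmetric])
  also have "\<dots> = (\<Sum>(j, k)\<in>Sigma {..?n} (\<lambda>j. {..?n - j}). ?F j k)"
    by (intro sum.cong) auto
  also have "\<dots> = (\<Sum>j\<le>?n. \<Sum>k\<le>?n - j. ?F j k)"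
    by (rule sum.Sigma [symmetric]) auto
  also have "\<dots> = (f \<otimes>\<^bsub>tensor_algebra\<^esub> (g \<otimes>\<^bsub>tensor_algebra\<^esub> h)) w"
    by (simp add: tensor_algebra_simps sum_distrib_left mult.assoc add.commute)
  finally show "((f \<otimes>\<^bsub>tensor_algebra\<^esub> g) \<otimes>\<^bsub>tensor_algebra\<^esub> h) w
      = (f \<otimes>\<^bsub>tensor_algebra\<^esub> (g \<otimes>\<^bsub>tensor_algebra\<^esub> h)) w" .
qed

lemma ring_tensor_algebra: "ring (tensor_algebra :: ('n list \<Rightarrow> real) ring)"
proof (rule ringI)
  show "abelian_group (tensor_algebra :: ('n list \<Rightarrow> real) ring)"
  proof (rule abelian_groupI)
    fix f g :: "'n list \<Rightarrow> real"
    assume fg: "f \<in> carrier tensor_algebra" "g \<in> carrier tensor_algebra"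
    show "f \<oplus>\<^bsub>tensor_algebra\<^esub> g \<in> carrier tensor_algebra"
      using fg by (auto simp: tensor_algebra_simps
          intro: finite_subset[of _ "{w. f w \<noteq> 0} \<union> {w. g w \<noteq> 0}"])
    show "\<exists>h\<in>carrier tensor_algebra. h \<oplus>\<^bsub>tensor_algebra\<^esub> f = \<zero>\<^bsub>tensor_algebra\<^esub>"
      using fg by (intro bexI[where x = "\<lambda>w. - f w"]) (auto simp: tensor_algebra_simps)
  qed (auto simp: tensor_algebra_simps algebra_simps)
next
  show "monoid (tensor_algebra :: ('n list \<Rightarrow> real) ring)"
  proof (rule monoidI)
    show "\<one>\<^bsub>tensor_algebra\<^esub> \<otimes>\<^bsub>tensor_algebra\<^esub> f = f" for f :: "'n list \<Rightarrow> real"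
    proof
      fix w :: "'n list"
      have "(\<Sum>k\<le>length w. (if take k w = [] then 1 else 0) * f (drop k w))
          = (\<Sum>k\<le>length w. if k = 0 then f w else 0)"
        by (intro sum.cong) auto
      then show "(\<one>\<^bsub>tensor_algebra\<^esub> \<otimes>\<^bsub>tensor_algebra\<^esub> f) w = f w"
        by (simp add: tensor_algebra_simps del: take_eq_Nil)
    qed
    show "f \<otimes>\<^bsub>tensor_algebra\<^esub> \<one>\<^bsub>tensor_algebra\<^esub> = f" for f :: "'n list \<Rightarrow> real"
    proof
      fix w :: "'n list"
      have "(\<Sum>k\<le>length w. f (take k w) * (if drop k w = [] then 1 else 0))
          = (\<Sum>k\<le>length w. if k = length w then f w else 0)"
        by (intro sum.cong) auto
      then show "(f \<otimes>\<^bsub>tensor_algebra\<^esub> \<one>\<^bsub>tensor_algebra\<^esub>) w = f w"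
        by (simp add: tensor_algebra_simps del: drop_eq_Nil)
    qed
    show "f \<otimes>\<^bsub>tensor_algebra\<^esub> g \<in> carrier tensor_algebra"
      if "f \<in> carrier tensor_algebra" "g \<in> carrier tensor_algebra" for f g :: "'n list \<Rightarrow> real"
      using that tensor_mult_closed by (simp add: tensor_algebra_simps)
  qed (simp_all add: tensor_mult_assoc, simp add: tensor_algebra_simps)
qed (auto simp: tensor_algebra_simps algebra_simps sum.distrib)

lemma tensor_scalar_closed: "tensor_scalar c \<in> carrier tensor_algebra"
proof -
  have "{w. tensor_scalar c w \<noteq> 0} \<subseteq> {[]}"
    by (auto simp: tensor_scalar_def)
  then show ?thesis
    unfolding tensor_algebra_simps mem_Collect_eq by (rule finite_subset) simp
qed

lemma tensor_vec_closed: "tensor_vec (v :: real ^ 'n::finite) \<in> carrier tensor_algebra"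
proof -
  have "{w. tensor_vec v w \<noteq> 0} \<subseteq> range (\<lambda>i. [i])"
    by (auto simp: tensor_vec_def split: list.split_asm)
  then show ?thesis
    unfolding tensor_algebra_simps mem_Collect_eq by (rule finite_subset) simp
qed

lemma clifford_relation_closed:
  "tensor_vec v \<otimes>\<^bsub>tensor_algebra\<^esub> tensor_vec v \<ominus>\<^bsub>tensor_algebra\<^esub> tensor_scalar c
     \<in> carrier tensor_algebra"
  by (intro ring.ring_simprules ring_tensor_algebra tensor_vec_closed tensor_scalar_closed)

lemma ideal_clifford: "ideal (clifford_ideal \<epsilon>) tensor_algebra"
  unfolding clifford_ideal_def
  by (intro ring.genideal_ideal ring_tensor_algebra) (auto intro: clifford_relation_closed)

lemma ring_clifford: "ring (clifford_algebra \<epsilon>)"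
  unfolding clifford_algebra_def by (rule ideal.quotient_is_ring [OF ideal_clifford])

lemma clifford_vec_closed: "clifford_vec \<epsilon> v \<in> carrier (clifford_algebra \<epsilon>)"
  unfolding clifford_algebra_def clifford_vec_def
  using ring_hom_closed [OF ideal.rcos_ring_hom [OF ideal_clifford] tensor_vec_closed] .

lemma clifford_vec_square:
  "clifford_vec \<epsilon> v \<otimes>\<^bsub>clifford_algebra \<epsilon>\<^esub> clifford_vec \<epsilon> v
     = clifford_ideal \<epsilon> +>\<^bsub>tensor_algebra\<^esub> tensor_scalar (\<epsilon> * (norm v)\<^sup>2)"
proof -
  let ?t = "tensor_vec v \<otimes>\<^bsub>tensor_algebra\<^esub> tensor_vec v"
  have t: "?t \<in> carrier tensor_algebra"
    by (intro ring.ring_simprules ring_tensor_algebra tensor_vec_closed)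
  have "?t \<ominus>\<^bsub>tensor_algebra\<^esub> tensor_scalar (\<epsilon> * (norm v)\<^sup>2) \<in> clifford_ideal \<epsilon>"
    unfolding clifford_ideal_def
    by (rule subsetD [OF ring.genideal_self [OF ring_tensor_algebra]])
      (auto intro: clifford_relation_closed)
  then have "clifford_ideal \<epsilon> +>\<^bsub>tensor_algebra\<^esub> ?t
      = clifford_ideal \<epsilon> +>\<^bsub>tensor_algebra\<^esub> tensor_scalar (\<epsilon> * (norm v)\<^sup>2)"
    using ring.quotient_eq_iff_same_a_r_cos [OF ring_tensor_algebra ideal_clifford t
        tensor_scalar_closed] by blast
  then show ?thesis
    unfolding clifford_algebra_def clifford_vec_def
    using ring_hom_mult [OF ideal.rcos_ring_hom [OF ideal_clifford]
        tensor_vec_closed tensor_vec_closed] by metis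
qed

lemma tensor_scalar_mult:
  "tensor_scalar a \<otimes>\<^bsub>tensor_algebra\<^esub> tensor_scalar b = tensor_scalar (a * b)"
proof
  fix w
  show "(tensor_scalar a \<otimes>\<^bsub>tensor_algebra\<^esub> tensor_scalar b) w = tensor_scalar (a * b) w"
    by (cases w) (auto simp: tensor_algebra_simps tensor_scalar_def intro!: sum.neutral)
qed

lemma clifford_scalar_mult:
  "(clifford_ideal \<epsilon> +>\<^bsub>tensor_algebra\<^esub> tensor_scalar a)
     \<otimes>\<^bsub>clifford_algebra \<epsilon>\<^esub> (clifford_ideal \<epsilon> +>\<^bsub>tensor_algebra\<^esub> tensor_scalar b)
   = clifford_ideal \<epsilon> +>\<^bsub>tensor_algebra\<^esub> tensor_scalar (a * b)"
  unfolding clifford_algebra_def tensor_scalar_mult [symmetric]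
  by (rule ring_hom_mult [OF ideal.rcos_ring_hom [OF ideal_clifford]
        tensor_scalar_closed tensor_scalar_closed, symmetric])

lemma clifford_vec_Units:
  fixes v :: "real ^ 'n::finite"
  assumes "\<epsilon> = 1 \<or> \<epsilon> = -1" and "norm v = 1"
  shows "clifford_vec \<epsilon> v \<in> Units (clifford_algebra \<epsilon>)"
proof -
  let ?C = "clifford_algebra \<epsilon> :: ('n list \<Rightarrow> real) set ring"
  interpret C: ring ?C by (rule ring_clifford)
  let ?x = "clifford_vec \<epsilon> v"
  let ?y = "?x \<otimes>\<^bsub>?C\<^esub> (?x \<otimes>\<^bsub>?C\<^esub> ?x)"
  have x: "?x \<in> carrier ?C" by (rule clifford_vec_closed)
  have one: "\<one>\<^bsub>?C\<^esub> = clifford_ideal \<epsilon> +>\<^bsub>tensor_algebra\<^esub> tensor_scalar 1"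
    unfolding tensor_scalar_def
    by (simp add: clifford_algebra_def FactRing_def tensor_algebra_simps)
  have "(\<epsilon> * (norm v)\<^sup>2) * (\<epsilon> * (norm v)\<^sup>2) = 1"
    using assms by auto
  then have four: "(?x \<otimes>\<^bsub>?C\<^esub> ?x) \<otimes>\<^bsub>?C\<^esub> (?x \<otimes>\<^bsub>?C\<^esub> ?x) = \<one>\<^bsub>?C\<^esub>"
    by (simp only: clifford_vec_square clifford_scalar_mult one)
  have right: "?x \<otimes>\<^bsub>?C\<^esub> ?y = \<one>\<^bsub>?C\<^esub>"
    using four C.m_assoc [OF x x C.m_closed [OF x x]] by metis
  have left: "?y \<otimes>\<^bsub>?C\<^esub> ?x = \<one>\<^bsub>?C\<^esub>"
    using right C.m_assoc [OF x C.m_closed [OF x x] x] C.m_assoc [OF x x x] by metis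
  have "?y \<in> carrier ?C"
    by (intro C.m_closed x)
  with x left right show ?thesis
    unfolding Units_def by blast
qed

lemma group_pin_group:
  assumes "\<epsilon> = 1 \<or> \<epsilon> = -1"
  shows "group (pin_group \<epsilon> :: ('n::finite list \<Rightarrow> real) set monoid)"
proof -
  interpret U: group "units_of (clifford_algebra \<epsilon> :: ('n list \<Rightarrow> real) set ring)"
    by (rule monoid.units_group [OF ring.is_monoid [OF ring_clifford]])
  show ?thesis
    unfolding pin_group_def
    by (intro U.subgroup_imp_group U.generate_is_subgroup)
      (auto simp: units_of_carrier intro: clifford_vec_Units [OF assms])
qed

end

theory Submission
  imports Defs
begin

text \<open>
  Naturality of a group \<open>G\<close> with at most continuum many elements is a question about one metric.
  The distance of a right-invariant metric depends only on the ratio \<open>x y\<inverse>\<close>, and by symmetry it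
  does not distinguish a ratio from its inverse. Any assignment of numbers in \<open>[1, 2)\<close> to ratios,
  constant on pairs \<open>{g, g\<inverse>}\<close>, satisfies the triangle inequality, so an injective assignment
  gives a finest right-invariant metric. Its isometries that fix the identity are the maps \<open>f\<close> with
  \<open>f x (f y)\<inverse> = (x y\<inverse>)\<^bsup>\<plusminus>1\<^esup>\<close>. If only the identity map has this property, then the right
  translations of any group on the same set that acts by isometries are right translations of \<open>G\<close>,
  which makes the two groups isomorphic (\<open>natural_if_ratio_preserving_trivial\<close>).

  Such an \<open>f\<close> sends every element to itself or to its inverse, and an element that is moved inverts
  by conjugation every element that is fixed. Involutions are fixed, so in \<open>Pin\<^sup>+(n)\<close>, which unit
  vectors of square \<open>1\<close> generate, a moved element commutes with all generators. It is then central,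
  which forces all generators to commute and all elements to be involutions
  (\<open>ratio_preserving_trivial_if_generated_by_involutions\<close>). Since inversion reverses products, it
  also suffices that two noncommuting elements and their product are fixed. In \<open>Pin\<^sup>-(n)\<close> with
  \<open>n \<ge> 3\<close> take orthonormal vectors \<open>e\<^sub>1, e\<^sub>2, e\<^sub>3\<close>. Conjugation by
  \<open>y = (e\<^sub>1 - e\<^sub>2) (e\<^sub>2 - e\<^sub>3) / 2\<close> permutes them cyclically and \<open>y\<^sup>3 = -1\<close>; comparing with
  \<open>y\<close> shows that \<open>e\<^sub>1\<close>, \<open>e\<^sub>2\<close> and \<open>e\<^sub>1 e\<^sub>2\<close> are fixed
  (\<open>ratio_preserving_trivial_if_cyclic_triple\<close>).

  For \<open>n \<le> 2\<close> any three vectors of the plane satisfy \<open>u v w = w v u\<close>. Hence the products of evenly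
  many unit vectors form an abelian subgroup \<open>E\<close> of index two in \<open>Pin\<^sup>-(n)\<close>, and each element outside
  \<open>E\<close> has square \<open>-1\<close>. Inserting the factor \<open>-1\<close> whenever both arguments lie outside \<open>E\<close> gives a
  second group structure. It turns the elements outside \<open>E\<close> into involutions, so it is not isomorphic
  to the old one, but its right translations preserve every right-invariant metric
  (\<open>not_natural_if_generators_reverse\<close>).

  All this needs few facts about the Clifford algebra: the formula for reflections, the reversal of
  products in the plane, and \<open>-1 \<noteq> 1\<close>. The last one holds because the algebra acts on the functions
  on the subsets of the index type.
\<close>

section \<open>Maps that preserve ratios up to inversion\<close>

lemma (in group) mult_left_extend:
  assumes "x \<otimes> y = u" "x \<in> carrier G" "y \<in> carrier G" "w \<in> carrier G"
  shows "x \<otimes> (y \<otimes> w) = u \<otimes> w"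
  using assms m_assoc by metis

text \<open>
  These maps are the isometries of the finest right-invariant metric that fix the identity.
\<close>

definition (in group) ratio_preserving :: "('a \<Rightarrow> 'a) \<Rightarrow> bool" where
  "ratio_preserving f \<longleftrightarrow>
     f \<in> carrier G \<rightarrow> carrier G \<and> f \<one> = \<one> \<and>
     (\<forall>x\<in>carrier G. \<forall>y\<in>carrier G. f x \<otimes> inv (f y) \<in> {x \<otimes> inv y, y \<otimes> inv x})"

lemma (in group) ratio_preserving_cases:
  assumes "ratio_preserving f" "x \<in> carrier G"
  shows "f x = x \<or> f x = inv x"
proof -
  have "f x \<otimes> inv (f \<one>) \<in> {x \<otimes> inv \<one>, \<one> \<otimes> inv x}" "f \<one> = \<one>" "f x \<in> carrier G"
    using assms unfolding ratio_preserving_def by blast+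
  then show ?thesis using assms(2) by auto
qed

text \<open>
  Of the two values allowed for \<open>f x (f y)\<inverse> = x\<inverse> y\<inverse>\<close>, the ratio \<open>x y\<inverse>\<close> is excluded because
  \<open>x\<close> is moved.
\<close>

lemma (in group) moved_inverts_fixed:
  assumes f: "ratio_preserving f"
    and x: "x \<in> carrier G" "f x \<noteq> x" and y: "y \<in> carrier G" "f y = y"
  shows "x \<otimes> y = inv y \<otimes> x"
proof -
  have fx: "f x = inv x" using ratio_preserving_cases [OF f x(1)] x(2) by blast
  have "inv x \<otimes> inv y \<in> {x \<otimes> inv y, y \<otimes> inv x}"
    using f x(1) y fx unfolding ratio_preserving_def by metis
  moreover have "inv x \<otimes> inv y \<noteq> x \<otimes> inv y"
    using x y fx by (metis inv_closed right_cancel)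
  ultimately have "inv x \<otimes> inv y = y \<otimes> inv x" by simp
  then have "x \<otimes> (inv x \<otimes> inv y) \<otimes> x = x \<otimes> (y \<otimes> inv x) \<otimes> x" by simp
  then have "x = y \<otimes> (x \<otimes> y)" using x y by (simp add: m_assoc inv_solve_left')
  then show ?thesis using x y by (simp add: inv_solve_left)
qed

lemma (in group) moved_pair:
  assumes f: "ratio_preserving f"
    and x: "x \<in> carrier G" "f x \<noteq> x" and y: "y \<in> carrier G" "f y \<noteq> y"
  shows "x \<otimes> y = y \<otimes> x \<or> x \<otimes> x = y \<otimes> y"
proof -
  have fx: "f x = inv x" and fy: "f y = inv y"
    using ratio_preserving_cases [OF f] x y by blast+
  have "inv x \<otimes> y \<in> {x \<otimes> inv y, y \<otimes> inv x}"
    using f x(1) y(1) fx fy unfolding ratio_preserving_def by (metis inv_inv)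
  then consider "inv x \<otimes> y = x \<otimes> inv y" | "inv x \<otimes> y = y \<otimes> inv x" by blast
  then show ?thesis
  proof cases
    case 1
    then have "x \<otimes> (inv x \<otimes> y) \<otimes> y = x \<otimes> (x \<otimes> inv y) \<otimes> y" by simp
    then show ?thesis using x y by (simp add: m_assoc inv_solve_left')
  next
    case 2
    then have "x \<otimes> (inv x \<otimes> y) \<otimes> x = x \<otimes> (y \<otimes> inv x) \<otimes> x" by simp
    then show ?thesis using x y by (simp add: m_assoc inv_solve_left')
  qed
qed

lemma (in group) commutes_with_generated:
  assumes V: "V \<subseteq> carrier G" and c: "c \<in> carrier G"
    and comm: "\<And>v. v \<in> V \<Longrightarrow> c \<otimes> v = v \<otimes> c" and g: "g \<in> generate G V"
  shows "c \<otimes> g = g \<otimes> c"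
  using g
proof induction
  case (inv h)
  then have h: "h \<in> carrier G" "c \<otimes> h = h \<otimes> c" using V comm by auto
  then have "inv h \<otimes> (c \<otimes> h) \<otimes> inv h = inv h \<otimes> (h \<otimes> c) \<otimes> inv h" by simp
  moreover have "inv h \<otimes> (h \<otimes> c) = c" using h(1) c by (metis m_assoc inv_closed l_inv l_one)
  ultimately show ?case using h(1) c by (simp add: m_assoc)
next
  case (eng g h)
  then have "g \<in> carrier G" "h \<in> carrier G" using generate_in_carrier [OF V] by auto
  then show ?case using eng c by (metis m_assoc)
qed (use c comm in auto)

lemma (in group) involution_fixed:
  assumes "ratio_preserving f" "v \<in> carrier G" "v \<otimes> v = \<one>"
  shows "f v = v"
  using ratio_preserving_cases [OF assms(1,2)] assms(2,3) by (metis inv_unique')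

text \<open>
  The generators are fixed, and they are their own inverses, so a moved element commutes with them
  and is central. Given a moved \<open>x\<close>, a fixed element is inverted by the central \<open>x\<close> and is therefore
  an involution. So each product \<open>v w\<close> of two generators is an involution or central; either way
  \<open>v\<close> and \<open>w\<close> commute. The group is then abelian and consists of involutions, all of them fixed.
\<close>

lemma (in group) ratio_preserving_trivial_if_generated_by_involutions:
  assumes V: "V \<subseteq> carrier G" and gen: "carrier G = generate G V"
    and inv: "\<And>v. v \<in> V \<Longrightarrow> v \<otimes> v = \<one>"
    and f: "ratio_preserving f" and x: "x \<in> carrier G"
  shows "f x = x"
proof (rule ccontr)
  assume moved: "f x \<noteq> x"
  have inv': "inv v = v" if "v \<in> V" for v
    using inv [OF that] that V by (metis inv_equality subsetD)
  have central: "c \<otimes> g = g \<otimes> c" if "c \<in> carrier G" "f c \<noteq> c" "g \<in> carrier G" for c g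
  proof (rule commutes_with_generated [OF V])
    show "c \<otimes> v = v \<otimes> c" if "v \<in> V" for v
      using moved_inverts_fixed [OF f \<open>c \<in> carrier G\<close> \<open>f c \<noteq> c\<close>, of v]
        involution_fixed [OF f, of v] inv inv' that V by auto
  qed (use that gen in auto)
  have square: "g \<otimes> g = \<one>" if g: "g \<in> carrier G" "f g = g" for g
  proof -
    have "g \<otimes> x = inv g \<otimes> x"
      using moved_inverts_fixed [OF f x moved g] central [OF x moved g(1)] by simp
    then show ?thesis using g x by (metis inv_closed right_cancel r_inv)
  qed
  have VV: "v \<otimes> w = w \<otimes> v" if "v \<in> V" "w \<in> V" for v w
  proof -
    have vw: "v \<in> carrier G" "w \<in> carrier G" using that V by auto
    show ?thesis
    proof (cases "f (v \<otimes> w) = v \<otimes> w")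
      case True
      then have "inv (v \<otimes> w) = v \<otimes> w" using square vw by (metis inv_equality m_closed)
      then show ?thesis using vw that inv' by (simp add: inv_mult_group)
    next
      case False
      then have "(v \<otimes> w) \<otimes> v = v \<otimes> (v \<otimes> w)" using central vw by simp
      then show ?thesis using vw by (simp add: m_assoc)
    qed
  qed
  have abelian: "g \<otimes> h = h \<otimes> g" if g: "g \<in> carrier G" and h: "h \<in> carrier G" for g h
  proof -
    have "v \<otimes> g = g \<otimes> v" if "v \<in> V" for v
      using commutes_with_generated [OF V _ VV [OF that]] that V g gen by auto
    then show ?thesis
      using commutes_with_generated [OF V g, of h] h gen by auto
  qed
  have "g \<otimes> g = \<one>" if "g \<in> generate G V" for g
    using that
  proof induction
    case (eng g h)
    then have gh: "g \<in> carrier G" "h \<in> carrier G" using gen by auto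
    have "(g \<otimes> h) \<otimes> (g \<otimes> h) = (g \<otimes> g) \<otimes> (h \<otimes> h)"
      using abelian [OF gh] gh by (metis m_assoc m_closed)
    then show ?case using eng by simp
  qed (auto simp: inv inv')
  then have "f x = x" using involution_fixed [OF f x] x gen by auto
  with moved show False by contradiction
qed

text \<open>
  If \<open>g\<close> is moved, then any \<open>y\<close> is inverted by \<open>g\<close>, commutes with \<open>g\<close>, or has the same square. One
  \<open>y\<close> that does none of this certifies that \<open>g\<close> is fixed; \<open>y g y = g\<close> says that \<open>g\<close> inverts \<open>y\<close>.
\<close>

lemma (in group) fixed_if_not_normalised:
  assumes f: "ratio_preserving f" and g: "g \<in> carrier G" and y: "y \<in> carrier G"
    and "y \<otimes> g \<noteq> g \<otimes> y" "y \<otimes> g \<otimes> y \<noteq> g" "y \<otimes> y \<noteq> g \<otimes> g"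
  shows "f g = g"
proof (rule ccontr)
  assume moved: "f g \<noteq> g"
  show False
  proof (cases "f y = y")
    case True
    have "g \<otimes> y = inv y \<otimes> g" by (rule moved_inverts_fixed [OF f g moved y True])
    then have "y \<otimes> g \<otimes> y = g" using g y by (metis m_assoc m_closed inv_closed r_inv l_one)
    then show False using assms by simp
  next
    case False
    then show False using moved_pair [OF f g moved y False] assms by metis
  qed
qed

text \<open>
  Conjugation by a moved element is multiplicative, but on \<open>a\<close>, \<open>b\<close> and \<open>a b\<close> it agrees with
  inversion, which reverses products.
\<close>

lemma (in group) ratio_preserving_trivial_if_fixes_noncommuting:
  assumes f: "ratio_preserving f"
    and ab: "a \<in> carrier G" "b \<in> carrier G" "a \<otimes> b \<noteq> b \<otimes> a"
    and fixed: "f a = a" "f b = b" "f (a \<otimes> b) = a \<otimes> b"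
    and x: "x \<in> carrier G"
  shows "f x = x"
proof (rule ccontr)
  assume moved: "f x \<noteq> x"
  note inverts = moved_inverts_fixed [OF f x moved]
  have "inv (a \<otimes> b) \<otimes> x = x \<otimes> (a \<otimes> b)" using inverts [of "a \<otimes> b"] ab fixed by simp
  also have "\<dots> = inv a \<otimes> inv b \<otimes> x"
    using inverts [of a] inverts [of b] ab fixed x by (metis m_assoc inv_closed)
  finally have "inv (a \<otimes> b) = inv (b \<otimes> a)"
    using ab x by (simp add: inv_mult_group)
  then show False using ab by (metis inv_inv m_closed)
qed

text \<open>
  The hypotheses describe orthonormal vectors \<open>a, b, c\<close> of square \<open>z = -1\<close> and an element \<open>y\<close> that
  rotates them cyclically. The element \<open>y\<close> certifies that \<open>a\<close>, \<open>b\<close> and \<open>a b\<close> are fixed, by the same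
  argument each time: \<open>g\<close> and \<open>h = y g y\<inverse>\<close> anticommute and have square \<open>z\<close>. If \<open>y\<close> commuted with
  \<open>g\<close>, then \<open>h = g\<close> would anticommute with itself. If \<open>g\<close> inverted \<open>y\<close>, then \<open>y\<^sup>2 = g h\<close>, so that
  \<open>y\<^sup>4 = z = y\<^sup>3\<close>. If \<open>y\<^sup>2 = g\<^sup>2\<close>, then \<open>y\<^sup>2 = z = y\<^sup>3\<close>. The last two make \<open>y\<close> trivial, contrary to
  \<open>y\<^sup>3 = z\<close>.
\<close>

lemma (in group) ratio_preserving_trivial_if_cyclic_triple:
  assumes f: "ratio_preserving f"
    and car: "a \<in> carrier G" "b \<in> carrier G" "c \<in> carrier G" "y \<in> carrier G" "z \<in> carrier G"
    and z: "z \<noteq> \<one>" "z \<otimes> z = \<one>" "\<And>g. g \<in> carrier G \<Longrightarrow> g \<otimes> z = z \<otimes> g"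
    and squares: "a \<otimes> a = z" "b \<otimes> b = z" "c \<otimes> c = z"
    and anti: "b \<otimes> a = z \<otimes> (a \<otimes> b)" "c \<otimes> b = z \<otimes> (b \<otimes> c)" "c \<otimes> a = z \<otimes> (a \<otimes> c)"
    and cyc: "y \<otimes> a = b \<otimes> y" "y \<otimes> b = c \<otimes> y"
    and cube: "y \<otimes> y \<otimes> y = z"
    and x: "x \<in> carrier G"
  shows "f x = x"
proof -
  have zz: "z \<otimes> (z \<otimes> w) = w" if "w \<in> carrier G" for w
    using mult_left_extend [OF z(2) car(5,5) that] that by simp
  have gz: "g \<otimes> (z \<otimes> w) = z \<otimes> (g \<otimes> w)" if "g \<in> carrier G" "w \<in> carrier G" for g w
    using mult_left_extend [OF z(3) [OF that(1)] that(1) car(5) that(2)] that car by (simp add: m_assoc)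
  have square: "(g \<otimes> h) \<otimes> (g \<otimes> h) = z"
    if "g \<in> carrier G" "h \<in> carrier G" "g \<otimes> g = z" "h \<otimes> h = z" "h \<otimes> g = z \<otimes> (g \<otimes> h)" for g h
  proof -
    have "(g \<otimes> h) \<otimes> (g \<otimes> h) = g \<otimes> ((h \<otimes> g) \<otimes> h)" using that(1,2) by (simp add: m_assoc)
    also have "\<dots> = z \<otimes> (g \<otimes> (g \<otimes> (h \<otimes> h)))" using that(1,2,5) car gz [OF that(1)] by (simp add: m_assoc)
    also have "\<dots> = z \<otimes> (g \<otimes> (g \<otimes> z))" using that by simp
    also have "\<dots> = (g \<otimes> g) \<otimes> (z \<otimes> z)" using that(1) car gz [OF that(1)] by (simp add: m_assoc)
    also have "\<dots> = z" using that(3) z(2) car by simp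
    finally show ?thesis .
  qed
  have swap: "z \<otimes> g \<noteq> g" if "g \<in> carrier G" for g
    using that z(1) car by simp
  have y1: "y \<noteq> \<one>" using cube z(1) by auto
  have zy: "z \<otimes> y \<noteq> z" using y1 car by simp
  have fixed: "f g = g"
    if g: "g \<in> carrier G" "h \<in> carrier G" and sq: "g \<otimes> g = z" "h \<otimes> h = z"
      and anti: "h \<otimes> g = z \<otimes> (g \<otimes> h)" and yg: "y \<otimes> g = h \<otimes> y" for g h
  proof (rule fixed_if_not_normalised [OF f g(1) car(4)])
    show "y \<otimes> g \<noteq> g \<otimes> y"
    proof
      assume "y \<otimes> g = g \<otimes> y"
      then have "h = g" using yg g car by simp
      then show False using anti swap [of "g \<otimes> g"] g by simp
    qed
    show "y \<otimes> y \<noteq> g \<otimes> g"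
    proof
      assume "y \<otimes> y = g \<otimes> g"
      then show False using cube sq zy by simp
    qed
    show "y \<otimes> g \<otimes> y \<noteq> g"
    proof
      assume "y \<otimes> g \<otimes> y = g"
      then have "h \<otimes> (y \<otimes> y) = g" using yg g car by (simp add: m_assoc)
      then have "h \<otimes> (h \<otimes> (y \<otimes> y)) = h \<otimes> g" by simp
      then have "z \<otimes> (y \<otimes> y) = z \<otimes> (g \<otimes> h)"
        using mult_left_extend [OF sq(2) g(2,2), of "y \<otimes> y"] anti car by simp
      then have yy: "y \<otimes> y = g \<otimes> h" using g car by simp
      have "z \<otimes> y = y \<otimes> y \<otimes> (y \<otimes> y)"
        using cube car by (simp add: m_assoc z(3))
      then have "z \<otimes> y = z" using yy square [OF g sq anti] by simp
      then show False using zy by contradiction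
    qed
  qed
  have "f a = a" "f b = b" using fixed [of a b] fixed [of b c] car squares anti cyc by simp_all
  moreover have "f (a \<otimes> b) = a \<otimes> b"
  proof (rule fixed [of _ "b \<otimes> c"])
    show "(a \<otimes> b) \<otimes> (a \<otimes> b) = z" "(b \<otimes> c) \<otimes> (b \<otimes> c) = z"
      using square car squares anti by simp_all
    have "(b \<otimes> c) \<otimes> (a \<otimes> b) = b \<otimes> ((c \<otimes> a) \<otimes> b)" using car by (simp add: m_assoc)
    also have "\<dots> = z \<otimes> ((b \<otimes> a) \<otimes> (c \<otimes> b))"
      unfolding anti(3) using car gz [OF car(1)] gz [OF car(2)] by (simp add: m_assoc)
    also have "\<dots> = z \<otimes> ((a \<otimes> b) \<otimes> (b \<otimes> c))"
      unfolding anti(1,2) using car gz [OF car(1)] gz [OF car(2)] zz by (simp add: m_assoc)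
    finally show "(b \<otimes> c) \<otimes> (a \<otimes> b) = z \<otimes> ((a \<otimes> b) \<otimes> (b \<otimes> c))" .
    have "y \<otimes> (a \<otimes> b) = (y \<otimes> a) \<otimes> b" using car by (simp add: m_assoc)
    also have "\<dots> = b \<otimes> (y \<otimes> b)" unfolding cyc(1) using car by (simp add: m_assoc)
    also have "\<dots> = b \<otimes> c \<otimes> y" unfolding cyc(2) using car by (simp add: m_assoc)
    finally show "y \<otimes> (a \<otimes> b) = b \<otimes> c \<otimes> y" .
  qed (use car in auto)
  moreover have "a \<otimes> b \<noteq> b \<otimes> a" using anti(1) swap [of "a \<otimes> b"] car by simp
  ultimately show ?thesis
    using ratio_preserving_trivial_if_fixes_noncommuting [OF f car(1,2)] x by blast
qed

section \<open>The finest right-invariant metric\<close>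

text \<open>
  The minimum makes the value depend only on the pair \<open>{g, g\<inverse>}\<close> formed by a ratio \<open>g\<close>. For \<open>h\<close>
  injective on the group it is injective in that pair.
\<close>

definition finest_metric :: "('a, 'b) monoid_scheme \<Rightarrow> ('a \<Rightarrow> real) \<Rightarrow> 'a \<Rightarrow> 'a \<Rightarrow> real" where
  "finest_metric G h x y =
     (if x = y then 0
      else 1 + min (h (x \<otimes>\<^bsub>G\<^esub> inv\<^bsub>G\<^esub> y)) (h (y \<otimes>\<^bsub>G\<^esub> inv\<^bsub>G\<^esub> x)))"

text \<open>
  Distances of distinct points lie in \<open>[1, 2)\<close>, hence the triangle inequality.
\<close>

lemma (in group) Metric_space_finest:
  assumes h: "\<And>g. 0 \<le> h g \<and> h g < 1"
  shows "Metric_space (carrier G) (finest_metric G h)"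
proof
  have bounds: "finest_metric G h x y \<le> 2" "x \<noteq> y \<Longrightarrow> 1 \<le> finest_metric G h x y" for x y
    using h [of "x \<otimes> inv y"] h [of "y \<otimes> inv x"] by (auto simp: finest_metric_def)
  show "0 \<le> finest_metric G h x y" for x y
    using bounds(2) [of x y] by (cases "x = y") (auto simp: finest_metric_def)
  show "finest_metric G h x y = finest_metric G h y x" for x y
    by (simp add: finest_metric_def min.commute)
  show "finest_metric G h x y = 0 \<longleftrightarrow> x = y" for x y
    using bounds(2) [of x y] by (auto simp: finest_metric_def)
  show "finest_metric G h x w \<le> finest_metric G h x y + finest_metric G h y w" for x y w
    using bounds(1) [of x w] bounds(2) [of x y] bounds(2) [of y w]
    by (cases "x = y"; cases "y = w") (auto simp: finest_metric_def)
qed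

lemma (in group) bij_betw_right_translation:
  assumes "g \<in> carrier G"
  shows "bij_betw (\<lambda>x. x \<otimes> g) (carrier G) (carrier G)"
  by (rule bij_betwI [where g = "\<lambda>x. x \<otimes> inv g"]) (use assms in \<open>auto simp: m_assoc\<close>)

lemma (in group) right_invariant_finest: "right_invariant G (finest_metric G h)"
proof -
  have "(x \<otimes> g) \<otimes> inv (y \<otimes> g) = x \<otimes> inv y"
    if "x \<in> carrier G" "y \<in> carrier G" "g \<in> carrier G" for x y g
    using that mult_left_extend [OF r_inv, of g "inv y"] by (simp add: inv_mult_group m_assoc)
  then show ?thesis
    unfolding right_invariant_def isometry_of_def
    by (auto simp: finest_metric_def bij_betw_right_translation)
qed

lemma (in group) finest_metric_eqD:
  assumes h: "inj_on h (carrier G)"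
    and eq: "finest_metric G h x y = finest_metric G h u v" and ne: "x \<noteq> y" "u \<noteq> v"
    and car: "x \<in> carrier G" "y \<in> carrier G" "u \<in> carrier G" "v \<in> carrier G"
  shows "x \<otimes> inv y \<in> {u \<otimes> inv v, v \<otimes> inv u}"
proof -
  define p q where "p = x \<otimes> inv y" and "q = u \<otimes> inv v"
  have pq: "p \<in> carrier G" "q \<in> carrier G" using car by (simp_all add: p_def q_def)
  have invs: "y \<otimes> inv x = inv p" "v \<otimes> inv u = inv q"
    using car by (simp_all add: p_def q_def inv_mult_group)
  have "min (h p) (h (inv p)) = min (h q) (h (inv q))"
    using eq ne by (simp add: finest_metric_def invs) (simp add: p_def q_def)
  then have "h p = h q \<or> h p = h (inv q) \<or> h (inv p) = h q \<or> h (inv p) = h (inv q)"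
    by linarith
  then have "p = q \<or> p = inv q \<or> inv p = q \<or> inv p = inv q"
    using inj_on_eq_iff [OF h] pq by (meson inv_closed)
  then have "p = q \<or> p = inv q" using pq inv_inv by metis
  then show ?thesis by (simp add: p_def [symmetric] q_def [symmetric] invs)
qed

text \<open>
  Let \<open>\<circ>\<close> be the multiplication of a competing group \<open>H\<close>. Right translation by \<open>k\<close> in \<open>H\<close>, followed
  by the right translation of \<open>G\<close> that brings the image of \<open>1\<close> back to \<open>1\<close>, preserves ratios up to
  inversion and is therefore the identity: \<open>x \<circ> k = x (1 \<circ> k)\<close>. So \<open>k \<mapsto> 1 \<circ> k\<close> is multiplicative,
  and it is bijective as a left translation of \<open>H\<close>. It need not be the identity, as the unit of
  \<open>H\<close> may differ from \<open>1\<close>.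
\<close>

lemma (in group) natural_if_ratio_preserving_trivial:
  assumes small: "carrier G \<lesssim> (UNIV :: real set)"
    and rigid: "\<And>f x. \<lbrakk>ratio_preserving f; x \<in> carrier G\<rbrakk> \<Longrightarrow> f x = x"
  shows "natural_group G"
proof -
  have "carrier G \<lesssim> {0..<1::real}"
    using small reals_lepoll_reals01 lepoll_trans by blast
  then obtain h0 where h0: "inj_on h0 (carrier G)" "h0 ` carrier G \<subseteq> {0..<1::real}"
    unfolding lepoll_def by blast
  define h where "h g = (if g \<in> carrier G then h0 g else 0)" for g
  have h: "inj_on h (carrier G)" using h0(1) by (simp add: h_def inj_on_def)
  have bounds: "0 \<le> h g \<and> h g < 1" for g using h0(2) by (auto simp: h_def)
  define d where "d = finest_metric G h"
  have "H \<cong> G"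
    if H: "group H" "carrier H = carrier G" "right_invariant H d" for H :: "'a monoid"
  proof -
    interpret H: group H by (rule H(1))
    have agree: "x \<otimes>\<^bsub>H\<^esub> k = x \<otimes> (\<one> \<otimes>\<^bsub>H\<^esub> k)" if x: "x \<in> carrier G" and k: "k \<in> carrier G" for x k
    proof -
      define c where "c = \<one> \<otimes>\<^bsub>H\<^esub> k"
      define f where "f y = (y \<otimes>\<^bsub>H\<^esub> k) \<otimes> inv c" for y
      have closed: "y \<otimes>\<^bsub>H\<^esub> k \<in> carrier G" if "y \<in> carrier G" for y
        using that k H.m_closed H(2) by metis
      have c: "c \<in> carrier G" unfolding c_def by (rule closed) simp
      have f_closed: "f y \<in> carrier G" if "y \<in> carrier G" for y
        using closed that c by (simp add: f_def)
      have iso: "d (f y) (f w) = d y w" if "y \<in> carrier G" "w \<in> carrier G" for y w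
      proof -
        have "d (f y) (f w) = d (y \<otimes>\<^bsub>H\<^esub> k) (w \<otimes>\<^bsub>H\<^esub> k)"
          using right_invariant_finest closed that c
          unfolding f_def d_def right_invariant_def isometry_of_def by simp
        also have "\<dots> = d y w"
          using H that k unfolding right_invariant_def isometry_of_def by simp
        finally show ?thesis .
      qed
      have inj: "f y = f w \<longleftrightarrow> y = w" if "y \<in> carrier G" "w \<in> carrier G" for y w
        using that k closed c H(2) H.right_cancel [of k y w] unfolding f_def by simp
      have "ratio_preserving f"
        unfolding ratio_preserving_def
      proof (intro conjI ballI)
        show "f \<one> = \<one>" using c by (simp add: f_def c_def [symmetric])
        show "f \<in> carrier G \<rightarrow> carrier G" using f_closed by blast
        fix y w assume yw: "y \<in> carrier G" "w \<in> carrier G"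
        show "f y \<otimes> inv (f w) \<in> {y \<otimes> inv w, w \<otimes> inv y}"
        proof (cases "y = w")
          case True
          then show ?thesis using f_closed yw by simp
        next
          case False
          show ?thesis
            by (rule finest_metric_eqD [OF h])
              (use iso [OF yw] inj [OF yw] f_closed yw False in \<open>simp_all add: d_def\<close>)
        qed
      qed
      then have "f x = x" using rigid x by blast
      then have "x \<otimes> c = x \<otimes>\<^bsub>H\<^esub> k"
        unfolding f_def using closed [OF x] c x by (simp add: inv_solve_right')
      then show ?thesis by (simp add: c_def)
    qed
    have "(\<lambda>k. \<one> \<otimes>\<^bsub>H\<^esub> k) \<in> iso H G"
    proof (rule isoI)
      have one: "\<one> \<in> carrier H" using H(2) by simp
      show "(\<lambda>k. \<one> \<otimes>\<^bsub>H\<^esub> k) \<in> hom H G"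
      proof (rule homI)
        show "\<one> \<otimes>\<^bsub>H\<^esub> k \<in> carrier G" if "k \<in> carrier H" for k
          using H.m_closed [OF one that] H(2) by simp
        show "\<one> \<otimes>\<^bsub>H\<^esub> (k \<otimes>\<^bsub>H\<^esub> l) = (\<one> \<otimes>\<^bsub>H\<^esub> k) \<otimes> (\<one> \<otimes>\<^bsub>H\<^esub> l)"
          if kl: "k \<in> carrier H" "l \<in> carrier H" for k l
        proof -
          have "\<one> \<otimes>\<^bsub>H\<^esub> (k \<otimes>\<^bsub>H\<^esub> l) = (\<one> \<otimes>\<^bsub>H\<^esub> k) \<otimes>\<^bsub>H\<^esub> l"
            using H.m_assoc [OF one kl] by simp
          also have "\<dots> = (\<one> \<otimes>\<^bsub>H\<^esub> k) \<otimes> (\<one> \<otimes>\<^bsub>H\<^esub> l)"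
            using agree [of "\<one> \<otimes>\<^bsub>H\<^esub> k" l] H.m_closed [OF one kl(1)] kl(2) H(2) by simp
          finally show ?thesis .
        qed
      qed
      have "bij_betw (\<lambda>k. \<one> \<otimes>\<^bsub>H\<^esub> k) (carrier H) (carrier H)"
        by (rule bij_betwI [where g = "\<lambda>k. inv\<^bsub>H\<^esub> \<one> \<otimes>\<^bsub>H\<^esub> k"])
          (use one in \<open>auto simp: H.mult_left_extend [OF H.l_inv] H.mult_left_extend [OF H.r_inv]\<close>)
      then show "bij_betw (\<lambda>k. \<one> \<otimes>\<^bsub>H\<^esub> k) (carrier H) (carrier G)" using H(2) by simp
    qed
    then show ?thesis unfolding is_iso_def by blast
  qed
  moreover have "Metric_space (carrier G) d" "right_invariant G d"
    unfolding d_def using Metric_space_finest [of h] bounds right_invariant_finest by blast+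
  ultimately show ?thesis
    unfolding natural_group_def using is_group by blast
qed

section \<open>Twisting a group along a subgroup of index two\<close>

text \<open>
  The multiplication of \<open>G\<close> changed by the cocycle that is \<open>z\<close> on pairs outside \<open>E\<close> and \<open>1\<close> elsewhere.
\<close>

definition twisted_group :: "('a, 'b) monoid_scheme \<Rightarrow> 'a set \<Rightarrow> 'a \<Rightarrow> 'a monoid" where
  "twisted_group G E z =
     \<lparr>carrier = carrier G,
      mult = (\<lambda>x y. if x \<in> E \<or> y \<in> E then x \<otimes>\<^bsub>G\<^esub> y else z \<otimes>\<^bsub>G\<^esub> (x \<otimes>\<^bsub>G\<^esub> y)),
      one = \<one>\<^bsub>G\<^esub>\<rparr>"

text \<open>
  The elements outside \<open>E\<close> are called odd below. The prototype is a generalised dicyclic group, such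
  as the cyclic group of order four or \<open>S\<^sup>1 \<union> j S\<^sup>1\<close> inside the unit quaternions.
\<close>

locale index_two_with_square_roots = group G for G (structure) +
  fixes E :: "'a set" and z :: 'a
  assumes subgroup_E: "subgroup E G"
    and mult_odd: "\<lbrakk>x \<in> carrier G - E; y \<in> carrier G - E\<rbrakk> \<Longrightarrow> x \<otimes> y \<in> E"
    and z_E: "z \<in> E" and z_not_one: "z \<noteq> \<one>" and z_square: "z \<otimes> z = \<one>"
    and z_central: "x \<in> carrier G \<Longrightarrow> x \<otimes> z = z \<otimes> x"
    and square_odd: "x \<in> carrier G - E \<Longrightarrow> x \<otimes> x = z"
    and ex_odd: "carrier G - E \<noteq> {}"
begin

abbreviation "H \<equiv> twisted_group G E z"

lemma z_closed: "z \<in> carrier G"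
  using z_E subgroup.subset [OF subgroup_E] by blast

lemma mult_in_E_iff:
  assumes "x \<in> carrier G" "y \<in> carrier G"
  shows "x \<otimes> y \<in> E \<longleftrightarrow> (x \<in> E \<longleftrightarrow> y \<in> E)"
proof -
  interpret E: subgroup E G by (rule subgroup_E)
  have cancel: "inv x \<otimes> (x \<otimes> y) = y" "(x \<otimes> y) \<otimes> inv y = x"
    using assms by (simp_all only: inv_solve_left' inv_solve_right' m_closed)
  show ?thesis
  proof (cases "x \<in> E")
    case True
    then have "x \<otimes> y \<in> E" if "y \<in> E" using that by (rule E.m_closed)
    moreover have "y \<in> E" if "x \<otimes> y \<in> E"
      using E.m_closed [OF E.m_inv_closed [OF True] that] unfolding cancel(1) .
    ultimately show ?thesis using True by blast
  next
    case False
    then have "x \<otimes> y \<in> E" if "y \<notin> E" using mult_odd assms that by blast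
    moreover have "x \<in> E" if "x \<otimes> y \<in> E" "y \<in> E"
      using E.m_closed [OF that(1) E.m_inv_closed [OF that(2)]] unfolding cancel(2) .
    ultimately show ?thesis using False by blast
  qed
qed

lemma z_left_commute:
  assumes "x \<in> carrier G" "y \<in> carrier G"
  shows "x \<otimes> (z \<otimes> y) = z \<otimes> (x \<otimes> y)"
  using mult_left_extend [OF z_central assms(1) z_closed assms(2)] assms z_closed by (simp add: m_assoc)

lemma z_z:
  assumes "x \<in> carrier G"
  shows "z \<otimes> (z \<otimes> x) = x"
  using mult_left_extend [OF z_square z_closed z_closed assms] assms by simp

lemma twisted_carrier: "carrier H = carrier G"
  by (simp add: twisted_group_def)

lemma twisted_one: "\<one>\<^bsub>H\<^esub> = \<one>"
  by (simp add: twisted_group_def)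

lemma twisted_mult:
  "x \<otimes>\<^bsub>H\<^esub> y = (if x \<in> E \<or> y \<in> E then x \<otimes> y else z \<otimes> (x \<otimes> y))"
  by (simp add: twisted_group_def)

lemma group_twisted: "group H"
proof (rule groupI)
  have one: "\<one> \<in> E" by (rule subgroup.one_closed [OF subgroup_E])
  show "x \<otimes>\<^bsub>H\<^esub> y \<in> carrier H" if "x \<in> carrier H" "y \<in> carrier H" for x y
    using that z_closed by (simp add: twisted_carrier twisted_mult)
  show "\<one>\<^bsub>H\<^esub> \<in> carrier H" by (simp add: twisted_carrier twisted_one)
  show "\<one>\<^bsub>H\<^esub> \<otimes>\<^bsub>H\<^esub> x = x" if "x \<in> carrier H" for x
    using that one by (simp add: twisted_carrier twisted_one twisted_mult)
  show "\<exists>y\<in>carrier H. y \<otimes>\<^bsub>H\<^esub> x = \<one>\<^bsub>H\<^esub>" if x: "x \<in> carrier H" for x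
  proof (cases "x \<in> E")
    case True
    then show ?thesis
      using x by (intro bexI [of _ "inv x"]) (auto simp: twisted_carrier twisted_one twisted_mult)
  next
    case False
    then show ?thesis
      using x square_odd [of x] z_square
      by (intro bexI [of _ x]) (auto simp: twisted_carrier twisted_one twisted_mult)
  qed
  show "x \<otimes>\<^bsub>H\<^esub> y \<otimes>\<^bsub>H\<^esub> w = x \<otimes>\<^bsub>H\<^esub> (y \<otimes>\<^bsub>H\<^esub> w)"
    if "x \<in> carrier H" "y \<in> carrier H" "w \<in> carrier H" for x y w
    using that z_closed z_E
    by (cases "x \<in> E"; cases "y \<in> E"; cases "w \<in> E")
      (simp_all add: twisted_carrier twisted_mult mult_in_E_iff m_assoc z_left_commute)
qed

text \<open>
  Twisted translation by an odd \<open>g\<close> is translation by \<open>g\<close> after the map that multiplies odd elements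
  by \<open>z\<close>. That map keeps the ratio of two elements of equal parity. The ratio \<open>w\<close> of an even and an
  odd element is odd, and the map replaces it by \<open>w z = w\<inverse>\<close>, which a symmetric right-invariant
  distance does not distinguish from \<open>w\<close>.
\<close>

lemma twisted_right_invariant:
  assumes d: "Metric_space (carrier G) d" and inv: "right_invariant G d"
  shows "right_invariant H d"
  unfolding right_invariant_def isometry_of_def
proof (intro ballI conjI)
  interpret d: Metric_space "carrier G" d by (rule d)
  interpret H: group H by (rule group_twisted)
  fix g assume g: "g \<in> carrier H"
  show "bij_betw (\<lambda>x. x \<otimes>\<^bsub>H\<^esub> g) (carrier H) (carrier H)"
    by (rule H.bij_betw_right_translation [OF g])
  have trans: "d (x \<otimes> h) (y \<otimes> h) = d x y"
    if "x \<in> carrier G" "y \<in> carrier G" "h \<in> carrier G" for x y h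
    using inv that unfolding right_invariant_def isometry_of_def by blast
  have z_trans: "d (z \<otimes> x) (z \<otimes> y) = d x y" if "x \<in> carrier G" "y \<in> carrier G" for x y
    using trans [of x y z] z_central z_closed that by simp
  have mixed: "d x (z \<otimes> y) = d x y"
    if x: "x \<in> carrier G" and y: "y \<in> carrier G" and "x \<in> E \<longleftrightarrow> y \<notin> E" for x y
  proof -
    define w where "w = x \<otimes> inv y"
    have w: "w \<in> carrier G" "w \<notin> E" "x = w \<otimes> y"
      using that mult_in_E_iff [of w y] by (auto simp: w_def m_assoc)
    have "d x (z \<otimes> y) = d w z" using trans [of w z y] w y z_closed by simp
    also have "\<dots> = d (\<one> \<otimes> w) (w \<otimes> w)" using square_odd w by simp
    also have "\<dots> = d w \<one>" using trans [of \<one> w w] w d.commute [of w \<one>] by simp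
    also have "\<dots> = d x y" using trans [of w \<one> y] w y by simp
    finally show ?thesis .
  qed
  fix x y assume "x \<in> carrier H" "y \<in> carrier H"
  then have xy: "x \<in> carrier G" "y \<in> carrier G" and g': "g \<in> carrier G"
    using g by (simp_all add: twisted_carrier)
  show "d (x \<otimes>\<^bsub>H\<^esub> g) (y \<otimes>\<^bsub>H\<^esub> g) = d x y"
  proof (cases "g \<in> E")
    case True
    then show ?thesis using trans xy g' by (simp add: twisted_mult)
  next
    case False
    have mixed_xy: "d x (z \<otimes> y) = d x y" "d (z \<otimes> x) y = d x y" if "x \<in> E \<longleftrightarrow> y \<notin> E"
      using mixed [of x y] mixed [of y x] that xy d.commute by auto
    have "u \<otimes>\<^bsub>H\<^esub> g = (if u \<in> E then u else z \<otimes> u) \<otimes> g" if "u \<in> carrier G" for u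
      using False that g' z_closed by (simp add: twisted_mult m_assoc)
    then have "d (x \<otimes>\<^bsub>H\<^esub> g) (y \<otimes>\<^bsub>H\<^esub> g)
        = d (if x \<in> E then x else z \<otimes> x) (if y \<in> E then y else z \<otimes> y)"
      using trans [of "if x \<in> E then x else z \<otimes> x" "if y \<in> E then y else z \<otimes> y" g] xy g' z_closed
      by simp
    also have "\<dots> = d x y" using mixed_xy z_trans xy by auto
    finally show ?thesis .
  qed
qed

text \<open>
  In the twisted group the odd elements are involutions and generate everything. In \<open>G\<close> all elements
  of square \<open>1\<close> lie in the proper subgroup \<open>E\<close>.
\<close>

lemma twisted_not_iso: "\<not> H \<cong> G"
proof
  interpret H: group H by (rule group_twisted)
  assume "H \<cong> G"
  then obtain \<theta> where \<theta>: "\<theta> \<in> iso H G" unfolding is_iso_def by blast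
  interpret \<theta>: group_hom H G \<theta>
    using \<theta> by (unfold_locales) (simp add: iso_def)
  obtain e where e: "e \<in> carrier G" "e \<notin> E" using ex_odd by blast
  have odd: "\<theta> x \<in> E" if x: "x \<in> carrier G" "x \<notin> E" for x
  proof (rule ccontr)
    assume "\<theta> x \<notin> E"
    moreover have \<theta>x: "\<theta> x \<in> carrier G" using x \<theta>.hom_closed twisted_carrier by simp
    ultimately have "\<theta> x \<otimes> \<theta> x = z" using square_odd by simp
    moreover have "x \<otimes>\<^bsub>H\<^esub> x = \<one>\<^bsub>H\<^esub>"
      using x square_odd z_square by (simp add: twisted_mult twisted_one)
    then have "\<theta> x \<otimes> \<theta> x = \<one>"
      using x \<theta>.hom_mult [of x x] \<theta>.hom_one twisted_carrier by simp
    ultimately show False using z_not_one by simp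
  qed
  have "\<theta> x \<in> E" if x: "x \<in> carrier G" for x
  proof (cases "x \<in> E")
    case True
    have xe: "x \<otimes> e \<in> carrier G" "x \<otimes> e \<notin> E" using x e True mult_in_E_iff by auto
    have "(x \<otimes> e) \<otimes>\<^bsub>H\<^esub> e = x"
      using xe e x square_odd [of e] z_left_commute [of x \<one>] z_central [of x] z_z z_closed
      by (simp add: twisted_mult m_assoc)
    then have "\<theta> x = \<theta> (x \<otimes> e) \<otimes> \<theta> e"
      using \<theta>.hom_mult [of "x \<otimes> e" e] xe e twisted_carrier by simp
    then show ?thesis using odd xe e subgroup.m_closed [OF subgroup_E] by simp
  qed (use odd x in blast)
  moreover have "e \<in> \<theta> ` carrier G"
    using \<theta> e twisted_carrier by (auto simp: iso_def bij_betw_def)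
  ultimately show False using e by auto
qed

theorem not_natural: "\<not> natural_group G"
  unfolding natural_group_def
  using group_twisted twisted_carrier twisted_right_invariant twisted_not_iso by blast

end

text \<open>
  The reversal law makes the products \<open>u v\<close> of two generators commute with each other:
  \<open>(u v w) t = w (v u t) = w t u v\<close>. It also makes each generator \<open>e\<close> invert them, because
  \<open>(u v)\<inverse> = v u\<close>. They generate an abelian subgroup \<open>E\<close> with \<open>G = E \<union> E e\<close>, and
  \<open>(a e)\<^sup>2 = a a\<inverse> e\<^sup>2 = z\<close> for \<open>a\<close> in \<open>E\<close>.
\<close>

lemma (in group) not_natural_if_generators_reverse:
  assumes V: "V \<subseteq> carrier G" "V \<noteq> {}" and gen: "carrier G = generate G V"
    and z: "z \<noteq> \<one>" "z \<otimes> z = \<one>" and square: "\<And>v. v \<in> V \<Longrightarrow> v \<otimes> v = z"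
    and reverse: "\<And>u v w. \<lbrakk>u \<in> V; v \<in> V; w \<in> V\<rbrakk> \<Longrightarrow> u \<otimes> v \<otimes> w = w \<otimes> v \<otimes> u"
  shows "\<not> natural_group G"
proof -
  define P where "P = {u \<otimes> v | u v. u \<in> V \<and> v \<in> V}"
  define E where "E = generate G P"
  obtain e where e: "e \<in> V" using V(2) by blast
  have Vc: "v \<in> carrier G" if "v \<in> V" for v using V that by blast
  note ec = Vc [OF e]
  have Pc: "P \<subseteq> carrier G" unfolding P_def using Vc by auto
  have zP: "z \<in> P" unfolding P_def using square [OF e] e by blast
  have zc: "z \<in> carrier G" using zP Pc by blast
  have sub: "subgroup E G" unfolding E_def by (rule generate_is_subgroup [OF Pc])
  interpret E: subgroup E G by (rule sub)
  have PE: "p \<in> E" if "p \<in> P" for p unfolding E_def by (rule generate.incl [OF that])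
  have Ec: "a \<in> carrier G" if "a \<in> E" for a using E.subset that by blast
  have zV: "z \<otimes> v = v \<otimes> z" if v: "v \<in> V" for v
    using square [OF v] Vc [OF v] m_assoc [of v v v] by simp
  have zg: "z \<otimes> g = g \<otimes> z" if "g \<in> carrier G" for g
    using commutes_with_generated [OF V(1) zc zV, of g] that gen by blast
  have inv_V: "inv v = z \<otimes> v" if v: "v \<in> V" for v
  proof (rule inv_equality)
    show "z \<otimes> v \<otimes> v = \<one>" using square [OF v] Vc [OF v] zc z(2) by (simp add: m_assoc)
  qed (use Vc [OF v] zc in auto)
  have inv_VV: "inv (u \<otimes> v) = v \<otimes> u" if uv: "u \<in> V" "v \<in> V" for u v
  proof -
    note c = Vc [OF uv(1)] Vc [OF uv(2)]
    have "inv (u \<otimes> v) = (z \<otimes> v) \<otimes> (z \<otimes> u)" using c inv_V uv by (simp add: inv_mult_group)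
    also have "\<dots> = (z \<otimes> z) \<otimes> (v \<otimes> u)" using c zc zg [of v] by (metis m_assoc m_closed)
    finally show ?thesis using c z by simp
  qed
  have PP: "p \<otimes> q = q \<otimes> p" if pq: "p \<in> P" "q \<in> P" for p q
  proof -
    obtain u v w t where p: "p = u \<otimes> v" "u \<in> V" "v \<in> V" and q: "q = w \<otimes> t" "w \<in> V" "t \<in> V"
      using pq unfolding P_def by blast
    note c = Vc [OF p(2)] Vc [OF p(3)] Vc [OF q(2)] Vc [OF q(3)]
    have "p \<otimes> q = (u \<otimes> v \<otimes> w) \<otimes> t" unfolding p(1) q(1) using c by (simp add: m_assoc)
    also have "\<dots> = w \<otimes> (v \<otimes> u \<otimes> t)" using reverse [of u v w] p q c by (simp add: m_assoc)
    also have "\<dots> = w \<otimes> (t \<otimes> u \<otimes> v)" using reverse [of v u t] p q by simp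
    also have "\<dots> = q \<otimes> p" unfolding p(1) q(1) using c by (simp add: m_assoc)
    finally show ?thesis .
  qed
  have EE: "a \<otimes> b = b \<otimes> a" if a: "a \<in> E" and b: "b \<in> E" for a b
  proof -
    have "p \<otimes> a = a \<otimes> p" if "p \<in> P" for p
      using commutes_with_generated [OF Pc _ PP [OF that]] that Pc a unfolding E_def by auto
    then show ?thesis
      using commutes_with_generated [OF Pc Ec [OF a], of b] b unfolding E_def by auto
  qed
  have e_inverts: "e \<otimes> a = inv a \<otimes> e" if "a \<in> E" for a
    using that unfolding E_def
  proof induction
    case one
    then show ?case using ec by simp
  next
    case (incl p)
    then obtain u v where p: "p = u \<otimes> v" "u \<in> V" "v \<in> V" unfolding P_def by blast
    note c = Vc [OF p(2)] Vc [OF p(3)]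
    show ?case
      using reverse [OF e p(2,3)] inv_VV [OF p(2,3)] c ec unfolding p(1) by (simp add: m_assoc)
  next
    case (inv p)
    then obtain u v where p: "p = u \<otimes> v" "u \<in> V" "v \<in> V" unfolding P_def by blast
    note c = Vc [OF p(2)] Vc [OF p(3)]
    show ?case
      using reverse [OF e p(3,2)] inv_VV [OF p(2,3)] inv_VV [OF p(3,2)] c ec unfolding p(1)
      by (simp add: m_assoc)
  next
    case (eng a b)
    then have ab: "a \<in> E" "b \<in> E" unfolding E_def by auto
    note c = Ec [OF ab(1)] Ec [OF ab(2)]
    have "e \<otimes> (a \<otimes> b) = (e \<otimes> a) \<otimes> b" using c ec by (simp add: m_assoc)
    also have "\<dots> = inv a \<otimes> (e \<otimes> b)" using eng c ec by (simp add: m_assoc)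
    also have "\<dots> = (inv a \<otimes> inv b) \<otimes> e" using eng c ec by (simp add: m_assoc)
    also have "inv a \<otimes> inv b = inv (a \<otimes> b)" using EE [OF ab] c by (simp add: inv_mult_group)
    finally show ?case .
  qed
  have shift: "(a \<otimes> e) \<otimes> b = (a \<otimes> inv b) \<otimes> e" if "a \<in> E" "b \<in> E" for a b
    using e_inverts [OF that(2)] Ec that ec by (simp add: m_assoc)
  have ee: "(a \<otimes> e) \<otimes> (b \<otimes> e) = (a \<otimes> inv b) \<otimes> z" if "a \<in> E" "b \<in> E" for a b
  proof -
    have "(a \<otimes> e) \<otimes> (b \<otimes> e) = ((a \<otimes> e) \<otimes> b) \<otimes> e" using Ec that ec by (simp add: m_assoc)
    also have "\<dots> = (a \<otimes> inv b) \<otimes> z"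
      unfolding shift [OF that] using Ec that ec zc square [OF e] by (simp add: m_assoc)
    finally show ?thesis .
  qed
  have coset: "g \<in> E \<or> (\<exists>a\<in>E. g = a \<otimes> e)" if "g \<in> generate G V" for g
    using that
  proof induction
    case one
    then show ?case by simp
  next
    case (incl v)
    have "v = (z \<otimes> (v \<otimes> e)) \<otimes> e"
      using Vc [OF incl] ec zc square [OF e] zg [of v] z
      by (simp add: m_assoc) (metis m_assoc r_one)
    moreover have "v \<otimes> e \<in> E" using PE incl e by (auto simp: P_def)
    then have "z \<otimes> (v \<otimes> e) \<in> E" by (rule E.m_closed [OF PE [OF zP]])
    ultimately show ?case by blast
  next
    case (inv v)
    have "z \<otimes> v = (v \<otimes> e) \<otimes> e"
      using Vc [OF inv] ec zg [of v] square [OF e] by (simp add: m_assoc)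
    moreover have "v \<otimes> e \<in> E" using PE inv e by (auto simp: P_def)
    ultimately show ?case using inv_V [OF inv] by auto
  next
    case (eng g h)
    have assoc: "a \<otimes> (b \<otimes> e) = (a \<otimes> b) \<otimes> e" if "a \<in> E" "b \<in> E" for a b
      using Ec that ec by (simp add: m_assoc)
    show ?case
      using eng.IH
    proof (elim disjE bexE)
      assume "g \<in> E" "h \<in> E"
      then show ?thesis by blast
    next
      fix b assume "g \<in> E" "b \<in> E" "h = b \<otimes> e"
      then show ?thesis using assoc by blast
    next
      fix a assume "a \<in> E" "g = a \<otimes> e" "h \<in> E"
      then show ?thesis using shift by blast
    next
      fix a b assume "a \<in> E" "g = a \<otimes> e" "b \<in> E" "h = b \<otimes> e"
      then show ?thesis using ee PE [OF zP] by simp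
    qed
  qed
  \<comment> \<open>An element of \<open>E\<close> commutes with itself and is inverted by \<open>e\<close>.\<close>
  have e_notin: "e \<notin> E"
  proof
    assume "e \<in> E"
    then have "e = inv e" using e_inverts ec by (metis inv_closed right_cancel)
    then show False using square [OF e] z(1) ec by (metis r_inv)
  qed
  have odd: "\<exists>a\<in>E. x = a \<otimes> e" if "x \<in> carrier G - E" for x
    using coset [of x] that gen by blast
  interpret index_two_with_square_roots G E z
  proof
    show "x \<otimes> y \<in> E" if xy: "x \<in> carrier G - E" "y \<in> carrier G - E" for x y
      using odd [OF xy(1)] odd [OF xy(2)] ee PE [OF zP] by auto
    show "x \<otimes> x = z" if "x \<in> carrier G - E" for x
      using odd [OF that] ee Ec zc by auto
    show "carrier G - E \<noteq> {}" using e_notin ec by blast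
    show "x \<otimes> z = z \<otimes> x" if "x \<in> carrier G" for x
      using zg [OF that] ..
    show "z \<in> E" by (rule PE [OF zP])
  qed (use z in auto)
  show ?thesis by (rule not_natural)
qed

section \<open>A representation of the Clifford algebra\<close>

text \<open>
  Order the index type by \<open>to_nat\<close> and identify a set of indices with the increasing product of its
  elements. Multiplying that product by \<open>e\<^sub>i\<close> toggles \<open>i\<close>. The sign arises from moving \<open>e\<^sub>i\<close> past the
  smaller factors, and a factor \<open>\<epsilon>\<close> from \<open>e\<^sub>i e\<^sub>i = \<epsilon>\<close>. The operators below are the transposes of these
  multiplications, which satisfy the same relations.
\<close>

definition letter_sign :: "real \<Rightarrow> 'n::finite \<Rightarrow> 'n set \<Rightarrow> real" where
  "letter_sign \<epsilon> i S =
     (- 1) ^ card {j \<in> S. to_nat j < to_nat i} * (if i \<in> S then \<epsilon> else 1)"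

definition letter_action :: "real \<Rightarrow> 'n::finite \<Rightarrow> ('n set \<Rightarrow> real) \<Rightarrow> 'n set \<Rightarrow> real" where
  "letter_action \<epsilon> i F = (\<lambda>S. letter_sign \<epsilon> i S * F (sym_diff S {i}))"

definition word_action :: "real \<Rightarrow> 'n::finite list \<Rightarrow> ('n set \<Rightarrow> real) \<Rightarrow> 'n set \<Rightarrow> real" where
  "word_action \<epsilon> w F = foldr (letter_action \<epsilon>) w F"

definition tensor_action ::
    "real \<Rightarrow> ('n::finite list \<Rightarrow> real) \<Rightarrow> ('n set \<Rightarrow> real) \<Rightarrow> 'n set \<Rightarrow> real" where
  "tensor_action \<epsilon> f F = (\<lambda>S. \<Sum>w | f w \<noteq> 0. f w * word_action \<epsilon> w F S)"

lemma letter_action_square: "letter_action \<epsilon> i (letter_action \<epsilon> i F) S = \<epsilon> * F S"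
proof -
  have "{j \<in> sym_diff S {i}. to_nat j < to_nat i} = {j \<in> S. to_nat j < to_nat i}" by auto
  then have "letter_sign \<epsilon> i S * letter_sign \<epsilon> i (sym_diff S {i}) = \<epsilon>"
    unfolding letter_sign_def by (cases "i \<in> S") (auto simp: minus_one_power_iff)
  moreover have "sym_diff (sym_diff S {i}) {i} = S" by auto
  ultimately show ?thesis
    unfolding letter_action_def by (metis mult.assoc)
qed

lemma letter_sign_toggle:
  assumes "i \<noteq> j"
  shows "letter_sign \<epsilon> i (sym_diff S {j}) =
    (if to_nat j < to_nat i then - 1 else 1) * letter_sign \<epsilon> i S"
proof (cases "to_nat j < to_nat i")
  case True
  let ?A = "{k \<in> S. to_nat k < to_nat i}"
  have *: "{k \<in> sym_diff S {j}. to_nat k < to_nat i} = (if j \<in> S then ?A - {j} else insert j ?A)"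
    using True by auto
  have "(- 1 :: real) ^ card {k \<in> sym_diff S {j}. to_nat k < to_nat i} = - ((- 1) ^ card ?A)"
  proof (cases "j \<in> S")
    case True
    then have "card ?A = Suc (card (?A - {j}))"
      using \<open>to_nat j < to_nat i\<close> by (intro card.remove) auto
    then show ?thesis unfolding * using True by simp
  next
    case False
    then have "card (insert j ?A) = Suc (card ?A)" by (intro card_insert_disjoint) auto
    then show ?thesis unfolding * using False by simp
  qed
  moreover have "i \<in> sym_diff S {j} \<longleftrightarrow> i \<in> S" using assms by auto
  ultimately show ?thesis using True unfolding letter_sign_def by simp
next
  case False
  then have "{k \<in> sym_diff S {j}. to_nat k < to_nat i} = {k \<in> S. to_nat k < to_nat i}" by auto
  moreover have "i \<in> sym_diff S {j} \<longleftrightarrow> i \<in> S" using assms by auto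
  ultimately show ?thesis using False unfolding letter_sign_def by simp
qed

lemma letter_action_anticommute:
  assumes "i \<noteq> j"
  shows "letter_action \<epsilon> i (letter_action \<epsilon> j F) S = - letter_action \<epsilon> j (letter_action \<epsilon> i F) S"
proof -
  have "to_nat i < to_nat j \<longleftrightarrow> \<not> to_nat j < to_nat i"
    using assms by (metis inj_to_nat injD linorder_neqE_nat order_less_asym)
  moreover have "sym_diff (sym_diff S {i}) {j} = sym_diff (sym_diff S {j}) {i}" by auto
  ultimately show ?thesis
    unfolding letter_action_def
    using letter_sign_toggle [OF assms, of \<epsilon> S] letter_sign_toggle [OF assms [symmetric], of \<epsilon> S]
    by simp
qed

lemma tensor_action_superset:
  assumes "finite A" "{w. f w \<noteq> 0} \<subseteq> A"
  shows "tensor_action \<epsilon> f F S = (\<Sum>w\<in>A. f w * word_action \<epsilon> w F S)"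
  unfolding tensor_action_def by (rule sum.mono_neutral_left) (use assms in auto)

lemma word_action_append: "word_action \<epsilon> (u @ v) F = word_action \<epsilon> u (word_action \<epsilon> v F)"
  by (simp add: word_action_def)

lemma word_action_sum:
  "word_action \<epsilon> w (\<lambda>S. \<Sum>v\<in>A. c v * F v S) = (\<lambda>S. \<Sum>v\<in>A. c v * word_action \<epsilon> w (F v) S)"
proof (induction w)
  case (Cons i w)
  then show ?case
    by (simp add: word_action_def letter_action_def sum_distrib_left mult.left_commute)
qed (simp add: word_action_def)

lemma tensor_action_mult:
  fixes f g :: "'n::finite list \<Rightarrow> real"
  assumes f: "f \<in> carrier tensor_algebra" and g: "g \<in> carrier tensor_algebra"
  shows "tensor_action \<epsilon> (f \<otimes>\<^bsub>tensor_algebra\<^esub> g) F = tensor_action \<epsilon> f (tensor_action \<epsilon> g F)"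
proof
  fix S
  let ?M = "{w. f w \<noteq> 0}" and ?N = "{w. g w \<noteq> 0}"
  let ?cat = "\<lambda>(u, v). u @ v :: 'n list"
  let ?W = "?cat ` (?M \<times> ?N)"
  have fin: "finite ?M" "finite ?N" using f g by (simp_all add: tensor_algebra_simps)
  have coeff: "(f \<otimes>\<^bsub>tensor_algebra\<^esub> g) w
      = (\<Sum>(u, v) | (u, v) \<in> ?M \<times> ?N \<and> ?cat (u, v) = w. f u * g v)" for w
  proof -
    let ?P = "(\<lambda>k. (take k w, drop k w)) ` {..length w}"
    have inj: "inj_on (\<lambda>k. (take k w, drop k w)) {..length w}"
      by (rule inj_on_inverseI [where g = "\<lambda>p. length (fst p)"]) simp
    have "(f \<otimes>\<^bsub>tensor_algebra\<^esub> g) w = (\<Sum>(u, v)\<in>?P. f u * g v)"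
      by (simp add: tensor_algebra_simps sum.reindex [OF inj])
    also have "\<dots> = (\<Sum>(u, v) | (u, v) \<in> ?M \<times> ?N \<and> ?cat (u, v) = w. f u * g v)"
    proof (rule sum.mono_neutral_right)
      show "{(u, v). (u, v) \<in> ?M \<times> ?N \<and> ?cat (u, v) = w} \<subseteq> ?P"
      proof clarify
        fix u v assume "f u \<noteq> 0" "g v \<noteq> 0"
        show "(u, v) \<in> (\<lambda>k. (take k (u @ v), drop k (u @ v))) ` {..length (u @ v)}"
          by (rule image_eqI [where x = "length u"]) auto
      qed
    qed auto
    finally show ?thesis .
  qed
  have W: "{w. (f \<otimes>\<^bsub>tensor_algebra\<^esub> g) w \<noteq> 0} \<subseteq> ?W"
  proof
    fix w assume "w \<in> {w. (f \<otimes>\<^bsub>tensor_algebra\<^esub> g) w \<noteq> 0}"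
    then obtain p where "p \<in> {(u, v). (u, v) \<in> ?M \<times> ?N \<and> ?cat (u, v) = w}"
      unfolding coeff mem_Collect_eq by (blast elim: sum.not_neutral_contains_not_neutral)
    then show "w \<in> ?W" by auto
  qed
  have "tensor_action \<epsilon> (f \<otimes>\<^bsub>tensor_algebra\<^esub> g) F S
      = (\<Sum>w\<in>?W. (f \<otimes>\<^bsub>tensor_algebra\<^esub> g) w * word_action \<epsilon> w F S)"
    by (rule tensor_action_superset [OF _ W]) (use fin in simp)
  also have "\<dots> = (\<Sum>w\<in>?W. \<Sum>(u, v) | (u, v) \<in> ?M \<times> ?N \<and> ?cat (u, v) = w.
           f u * g v * word_action \<epsilon> (u @ v) F S)"
    unfolding coeff sum_distrib_right by (intro sum.cong refl) auto
  also have "\<dots> = (\<Sum>(u, v)\<in>?M \<times> ?N. f u * g v * word_action \<epsilon> (u @ v) F S)"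
    using sum.image_gen [of "?M \<times> ?N" "\<lambda>(u, v). f u * g v * word_action \<epsilon> (u @ v) F S" ?cat] fin
    by (simp add: case_prod_unfold mem_Times_iff)
  also have "\<dots> = (\<Sum>u\<in>?M. \<Sum>v\<in>?N. f u * (g v * word_action \<epsilon> u (word_action \<epsilon> v F) S))"
    by (simp add: sum.cartesian_product word_action_append mult.assoc)
  also have "\<dots> = tensor_action \<epsilon> f (tensor_action \<epsilon> g F) S"
    unfolding tensor_action_def word_action_sum by (simp add: sum_distrib_left)
  finally show "tensor_action \<epsilon> (f \<otimes>\<^bsub>tensor_algebra\<^esub> g) F S
      = tensor_action \<epsilon> f (tensor_action \<epsilon> g F) S" .
qed

lemma tensor_action_add:
  assumes "f \<in> carrier tensor_algebra" "g \<in> carrier tensor_algebra"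
  shows "tensor_action \<epsilon> (f \<oplus>\<^bsub>tensor_algebra\<^esub> g) F S
    = tensor_action \<epsilon> f F S + tensor_action \<epsilon> g F S"
proof -
  let ?A = "{w. f w \<noteq> 0} \<union> {w. g w \<noteq> 0}"
  have "finite ?A" using assms by (simp add: tensor_algebra_simps)
  moreover have "{w. (f \<oplus>\<^bsub>tensor_algebra\<^esub> g) w \<noteq> 0} \<subseteq> ?A" by (auto simp: tensor_algebra_simps)
  ultimately show ?thesis
    using tensor_action_superset [of ?A f \<epsilon> F S] tensor_action_superset [of ?A g \<epsilon> F S]
      tensor_action_superset [of ?A "f \<oplus>\<^bsub>tensor_algebra\<^esub> g" \<epsilon> F S]
    by (simp add: tensor_algebra_simps distrib_right sum.distrib)
qed

lemma tensor_action_scalar: "tensor_action \<epsilon> (tensor_scalar c) F S = c * F S"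
  by (subst tensor_action_superset [where A = "{[]}"])
    (auto simp: tensor_scalar_def word_action_def)

lemma tensor_action_vec: "tensor_action \<epsilon> (tensor_vec v) F S = (\<Sum>i\<in>UNIV. v $ i * letter_action \<epsilon> i F S)"
proof -
  have "{w. tensor_vec v w \<noteq> 0} \<subseteq> range (\<lambda>i. [i])"
    by (auto simp: tensor_vec_def split: list.split_asm)
  then have "tensor_action \<epsilon> (tensor_vec v) F S
      = (\<Sum>w\<in>range (\<lambda>i. [i]). tensor_vec v w * word_action \<epsilon> w F S)"
    by (rule tensor_action_superset [rotated]) simp
  then show ?thesis
    by (simp add: sum.reindex inj_on_def tensor_vec_def word_action_def)
qed

lemma tensor_action_vec_square:
  fixes v :: "real ^ 'n::finite"
  shows "tensor_action \<epsilon> (tensor_vec v) (tensor_action \<epsilon> (tensor_vec v) F) S = \<epsilon> * (norm v)\<^sup>2 * F S"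
proof -
  let ?L = "letter_action \<epsilon>"
  let ?X = "\<lambda>i j. v $ i * (v $ j * ?L i (?L j F) S)"
  have "tensor_action \<epsilon> (tensor_vec v) (tensor_action \<epsilon> (tensor_vec v) F) S
      = (\<Sum>i\<in>UNIV. \<Sum>j\<in>UNIV. ?X i j)" (is "?l = _")
    using word_action_sum [of \<epsilon> "[_]" "\<lambda>j. v $ j" "\<lambda>j. ?L j F" UNIV]
    by (simp add: tensor_action_vec [abs_def] word_action_def sum_distrib_left)
  \<comment> \<open>Adding the sum to its copy with \<open>i\<close> and \<open>j\<close> exchanged cancels all terms off the diagonal.\<close>
  moreover have "\<dots> = (\<Sum>i\<in>UNIV. \<Sum>j\<in>UNIV. ?X j i)" by (rule sum.swap)
  ultimately have "2 * ?l = (\<Sum>i\<in>UNIV. \<Sum>j\<in>UNIV. ?X i j + ?X j i)"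
    by (simp add: sum.distrib)
  also have "\<dots> = (\<Sum>i\<in>UNIV. \<Sum>j\<in>UNIV. if j = i then 2 * (\<epsilon> * (v $ i)\<^sup>2 * F S) else 0)"
  proof (intro sum.cong refl)
    fix i j :: 'n
    show "?X i j + ?X j i = (if j = i then 2 * (\<epsilon> * (v $ i)\<^sup>2 * F S) else 0)"
      using letter_action_anticommute [of i j \<epsilon> F S] letter_action_square [of \<epsilon> i F S]
      by (simp add: power2_eq_square)
  qed
  also have "\<dots> = 2 * (\<epsilon> * (norm v)\<^sup>2 * F S)"
    unfolding power2_norm_eq_inner inner_vec_def
    by (simp add: sum_distrib_left sum_distrib_right power2_eq_square)
  finally show ?thesis by simp
qed

text \<open>
  The tensors that act as zero form an ideal, and it contains the defining relations because
  letters anticommute and have square \<open>\<epsilon>\<close>.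
\<close>

lemma tensor_action_clifford_ideal:
  fixes f :: "'n::finite list \<Rightarrow> real"
  assumes "f \<in> clifford_ideal \<epsilon>"
  shows "tensor_action \<epsilon> f F S = 0"
proof -
  let ?T = "tensor_algebra :: ('n list \<Rightarrow> real) ring"
  let ?K = "{f \<in> carrier ?T. \<forall>F S. tensor_action \<epsilon> f F S = 0}"
  interpret T: ring ?T by (rule ring_tensor_algebra)
  have zero: "tensor_action \<epsilon> \<zero>\<^bsub>?T\<^esub> F S = 0" for F S
    by (simp add: tensor_action_def tensor_algebra_simps)
  have neg: "tensor_action \<epsilon> (\<ominus>\<^bsub>?T\<^esub> g) F S = - tensor_action \<epsilon> g F S" if "g \<in> carrier ?T" for g F S
    using tensor_action_add [OF that T.a_inv_closed [OF that], of \<epsilon> F S] zero [of F S] that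
    by (simp add: T.r_neg)
  have absorb: "tensor_action \<epsilon> g (tensor_action \<epsilon> f F) S = 0"
    if "\<forall>F S. tensor_action \<epsilon> f F S = 0" for f g :: "'n list \<Rightarrow> real" and F S
  proof -
    have "word_action \<epsilon> w (\<lambda>S. 0) = (\<lambda>S. 0)" for w :: "'n list"
      using word_action_sum [of \<epsilon> w "\<lambda>_. 0" "\<lambda>_ _. 0" "{}"] by simp
    moreover have "tensor_action \<epsilon> f F = (\<lambda>S. 0)" using that by blast
    ultimately show ?thesis by (simp add: tensor_action_def [of _ g])
  qed
  have K: "ideal ?K ?T"
  proof (rule idealI [OF ring_tensor_algebra])
    show "subgroup ?K (add_monoid ?T)"
      by (rule T.add.subgroupI)
        (auto simp: tensor_action_add neg zero a_inv_def [symmetric]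
          intro!: exI [of _ "\<zero>\<^bsub>?T\<^esub>"])
  qed (auto simp: tensor_action_mult absorb)
  have "clifford_ideal \<epsilon> \<subseteq> ?K"
    unfolding clifford_ideal_def
  proof (rule T.genideal_minimal [OF K], clarify, intro conjI allI)
    fix v :: "real ^ 'n" and F :: "'n set \<Rightarrow> real" and S :: "'n set"
    show "tensor_vec v \<otimes>\<^bsub>?T\<^esub> tensor_vec v \<ominus>\<^bsub>?T\<^esub> tensor_scalar (\<epsilon> * (norm v)\<^sup>2) \<in> carrier ?T"
      by (rule clifford_relation_closed)
    show "tensor_action \<epsilon> (tensor_vec v \<otimes>\<^bsub>?T\<^esub> tensor_vec v
        \<ominus>\<^bsub>?T\<^esub> tensor_scalar (\<epsilon> * (norm v)\<^sup>2)) F S = 0"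
      by (simp add: a_minus_def tensor_action_add neg tensor_action_mult tensor_vec_closed
          tensor_scalar_closed tensor_action_vec_square tensor_action_scalar)
  qed
  then show ?thesis using assms by blast
qed

section \<open>Vectors and scalars in the Clifford algebra\<close>

definition clifford_scalar :: "real \<Rightarrow> real \<Rightarrow> ('n::finite list \<Rightarrow> real) set" where
  "clifford_scalar \<epsilon> c = clifford_ideal \<epsilon> +>\<^bsub>tensor_algebra\<^esub> tensor_scalar c"

lemma clifford_coset_hom:
  "(+>\<^bsub>tensor_algebra\<^esub>) (clifford_ideal \<epsilon>) \<in> ring_hom tensor_algebra (clifford_algebra \<epsilon>)"
  unfolding clifford_algebra_def by (rule ideal.rcos_ring_hom [OF ideal_clifford])

lemma tensor_scalar_mult_left:
  "tensor_scalar c \<otimes>\<^bsub>tensor_algebra\<^esub> f = (\<lambda>w. c * f w)"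
proof
  fix w
  have "(\<Sum>k\<le>length w. tensor_scalar c (take k w) * f (drop k w))
      = (\<Sum>k\<le>length w. if k = 0 then c * f w else 0)"
    by (intro sum.cong) (auto simp: tensor_scalar_def)
  then show "(tensor_scalar c \<otimes>\<^bsub>tensor_algebra\<^esub> f) w = c * f w"
    by (simp add: tensor_algebra_simps)
qed

lemma tensor_scalar_mult_right:
  "f \<otimes>\<^bsub>tensor_algebra\<^esub> tensor_scalar c = (\<lambda>w. c * f w)"
proof
  fix w
  have "(\<Sum>k\<le>length w. f (take k w) * tensor_scalar c (drop k w))
      = (\<Sum>k\<le>length w. if k = length w then c * f w else 0)"
    by (intro sum.cong) (auto simp: tensor_scalar_def)
  then show "(f \<otimes>\<^bsub>tensor_algebra\<^esub> tensor_scalar c) w = c * f w"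
    by (simp add: tensor_algebra_simps)
qed

context
  fixes \<epsilon> :: real
begin

abbreviation "Cl \<equiv> clifford_algebra \<epsilon>"
abbreviation "\<iota> \<equiv> clifford_vec \<epsilon>"
abbreviation "\<sigma> \<equiv> clifford_scalar \<epsilon>"

interpretation Cl: ring "Cl :: ('n::finite list \<Rightarrow> real) set ring"
  by (rule ring_clifford)

lemma clifford_scalar_closed: "\<sigma> c \<in> carrier Cl"
  unfolding clifford_scalar_def by (rule ring_hom_closed [OF clifford_coset_hom tensor_scalar_closed])

lemma clifford_scalar_one: "\<sigma> 1 = \<one>\<^bsub>Cl\<^esub>"
proof -
  have "tensor_scalar 1 = \<one>\<^bsub>tensor_algebra\<^esub>"
    by (auto simp: tensor_scalar_def tensor_algebra_simps)
  then show ?thesis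
    unfolding clifford_scalar_def using ring_hom_one [OF clifford_coset_hom] by metis
qed

lemma clifford_scalar_add: "\<sigma> (a + b) = \<sigma> a \<oplus>\<^bsub>Cl\<^esub> \<sigma> b"
proof -
  have "tensor_scalar (a + b) = tensor_scalar a \<oplus>\<^bsub>tensor_algebra\<^esub> tensor_scalar b"
    by (auto simp: tensor_scalar_def tensor_algebra_simps)
  then show ?thesis
    unfolding clifford_scalar_def
    using ring_hom_add [OF clifford_coset_hom tensor_scalar_closed tensor_scalar_closed] by metis
qed

lemma clifford_scalar_times: "\<sigma> a \<otimes>\<^bsub>Cl\<^esub> \<sigma> b = \<sigma> (a * b)"
  unfolding clifford_scalar_def by (rule clifford_scalar_mult)

lemma clifford_vec_add: "\<iota> (u + v) = \<iota> u \<oplus>\<^bsub>Cl\<^esub> \<iota> v"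
proof -
  have "tensor_vec (u + v) = tensor_vec u \<oplus>\<^bsub>tensor_algebra\<^esub> tensor_vec v"
    by (auto simp: tensor_vec_def tensor_algebra_simps split: list.split)
  then show ?thesis
    unfolding clifford_vec_def
    using ring_hom_add [OF clifford_coset_hom tensor_vec_closed tensor_vec_closed] by metis
qed

lemma clifford_vec_scaleR: "\<iota> (c *\<^sub>R v) = \<sigma> c \<otimes>\<^bsub>Cl\<^esub> \<iota> v"
proof -
  have "tensor_vec (c *\<^sub>R v) = tensor_scalar c \<otimes>\<^bsub>tensor_algebra\<^esub> tensor_vec v"
    by (auto simp: tensor_vec_def tensor_scalar_mult_left split: list.split)
  then show ?thesis
    unfolding clifford_vec_def clifford_scalar_def
    using ring_hom_mult [OF clifford_coset_hom tensor_scalar_closed tensor_vec_closed] by metis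
qed

lemma clifford_scalar_central_vec: "\<iota> v \<otimes>\<^bsub>Cl\<^esub> \<sigma> c = \<sigma> c \<otimes>\<^bsub>Cl\<^esub> \<iota> v"
proof -
  have "tensor_vec v \<otimes>\<^bsub>tensor_algebra\<^esub> tensor_scalar c
      = tensor_scalar c \<otimes>\<^bsub>tensor_algebra\<^esub> tensor_vec v"
    by (simp add: tensor_scalar_mult_left tensor_scalar_mult_right)
  then show ?thesis
    unfolding clifford_vec_def clifford_scalar_def
    using ring_hom_mult [OF clifford_coset_hom tensor_scalar_closed tensor_vec_closed]
      ring_hom_mult [OF clifford_coset_hom tensor_vec_closed tensor_scalar_closed] by metis
qed

lemma clifford_vec_mult_self: "\<iota> v \<otimes>\<^bsub>Cl\<^esub> \<iota> v = \<sigma> (\<epsilon> * (norm v)\<^sup>2)"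
  unfolding clifford_scalar_def by (rule clifford_vec_square)

text \<open>
  This is where the Clifford algebra is seen to be nontrivial: scalars act faithfully on functions.
\<close>

lemma clifford_scalar_inj:
  assumes "(\<sigma> a :: ('n::finite list \<Rightarrow> real) set) = \<sigma> b"
  shows "a = b"
proof -
  let ?T = "tensor_algebra :: ('n list \<Rightarrow> real) ring"
  interpret T: ring ?T by (rule ring_tensor_algebra)
  have "tensor_scalar a \<ominus>\<^bsub>?T\<^esub> tensor_scalar b \<in> clifford_ideal \<epsilon>"
    using assms unfolding clifford_scalar_def
    using T.quotient_eq_iff_same_a_r_cos [OF ideal_clifford tensor_scalar_closed tensor_scalar_closed]
    by blast
  moreover have "tensor_scalar a \<ominus>\<^bsub>?T\<^esub> tensor_scalar b = tensor_scalar (a - b)"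
  proof -
    have "tensor_scalar a = tensor_scalar (a - b) \<oplus>\<^bsub>?T\<^esub> tensor_scalar b"
      by (auto simp: tensor_scalar_def tensor_algebra_simps)
    then show ?thesis
      by (simp add: a_minus_def T.a_assoc T.r_neg tensor_scalar_closed)
  qed
  ultimately have "tensor_action \<epsilon> (tensor_scalar (a - b)) (\<lambda>S :: 'n set. 1) {} = 0"
    using tensor_action_clifford_ideal by metis
  then show ?thesis by (simp add: tensor_action_scalar)
qed

lemma clifford_anticommutator:
  "\<iota> u \<otimes>\<^bsub>Cl\<^esub> \<iota> v \<oplus>\<^bsub>Cl\<^esub> \<iota> v \<otimes>\<^bsub>Cl\<^esub> \<iota> u = \<sigma> (2 * \<epsilon> * (u \<bullet> v))"
proof -
  note closed = clifford_vec_closed [of \<epsilon> u] clifford_vec_closed [of \<epsilon> v]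
  let ?uv = "\<iota> u \<otimes>\<^bsub>Cl\<^esub> \<iota> v" and ?vu = "\<iota> v \<otimes>\<^bsub>Cl\<^esub> \<iota> u"
  let ?uu = "\<iota> u \<otimes>\<^bsub>Cl\<^esub> \<iota> u" and ?vv = "\<iota> v \<otimes>\<^bsub>Cl\<^esub> \<iota> v"
  have "(?uv \<oplus>\<^bsub>Cl\<^esub> ?vu) \<oplus>\<^bsub>Cl\<^esub> (?uu \<oplus>\<^bsub>Cl\<^esub> ?vv) = \<iota> (u + v) \<otimes>\<^bsub>Cl\<^esub> \<iota> (u + v)"
    unfolding clifford_vec_add using closed by (simp add: Cl.l_distr Cl.r_distr Cl.a_ac)
  also have "\<dots> = \<sigma> (2 * \<epsilon> * (u \<bullet> v) + (\<epsilon> * (norm u)\<^sup>2 + \<epsilon> * (norm v)\<^sup>2))"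
    unfolding clifford_vec_mult_self
    by (simp add: power2_norm_eq_inner inner_simps inner_commute algebra_simps)
  also have "\<dots> = \<sigma> (2 * \<epsilon> * (u \<bullet> v)) \<oplus>\<^bsub>Cl\<^esub> (?uu \<oplus>\<^bsub>Cl\<^esub> ?vv)"
    unfolding clifford_scalar_add clifford_vec_mult_self ..
  finally show ?thesis
    using closed by (simp add: Cl.add.right_cancel clifford_scalar_closed)
qed

text \<open>
  For a unit vector \<open>a\<close> this is, up to the sign \<open>- \<epsilon>\<close>, the reflection of \<open>x\<close> in the hyperplane
  orthogonal to \<open>a\<close>. It results from \<open>a x = 2 \<epsilon> \<langle>a, x\<rangle> - x a\<close> by multiplying with \<open>a\<close>.
\<close>

lemma clifford_reflection:
  "\<iota> a \<otimes>\<^bsub>Cl\<^esub> \<iota> x \<otimes>\<^bsub>Cl\<^esub> \<iota> a = \<iota> ((2 * \<epsilon> * (a \<bullet> x)) *\<^sub>R a - (\<epsilon> * (norm a)\<^sup>2) *\<^sub>R x)"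
proof -
  note closed = clifford_vec_closed [of \<epsilon> a] clifford_vec_closed [of \<epsilon> x]
  let ?y = "(2 * \<epsilon> * (a \<bullet> x)) *\<^sub>R a - (\<epsilon> * (norm a)\<^sup>2) *\<^sub>R x"
  have "\<iota> a \<otimes>\<^bsub>Cl\<^esub> \<iota> x \<otimes>\<^bsub>Cl\<^esub> \<iota> a \<oplus>\<^bsub>Cl\<^esub> \<iota> x \<otimes>\<^bsub>Cl\<^esub> (\<iota> a \<otimes>\<^bsub>Cl\<^esub> \<iota> a)
      = (\<iota> a \<otimes>\<^bsub>Cl\<^esub> \<iota> x \<oplus>\<^bsub>Cl\<^esub> \<iota> x \<otimes>\<^bsub>Cl\<^esub> \<iota> a) \<otimes>\<^bsub>Cl\<^esub> \<iota> a"
    using closed by (simp add: Cl.l_distr Cl.m_assoc)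
  also have "\<dots> = \<iota> ((2 * \<epsilon> * (a \<bullet> x)) *\<^sub>R a)"
    unfolding clifford_anticommutator clifford_vec_scaleR ..
  also have "\<dots> = \<iota> (?y + (\<epsilon> * (norm a)\<^sup>2) *\<^sub>R x)" by simp
  also have "\<dots> = \<iota> ?y \<oplus>\<^bsub>Cl\<^esub> \<iota> x \<otimes>\<^bsub>Cl\<^esub> (\<iota> a \<otimes>\<^bsub>Cl\<^esub> \<iota> a)"
    unfolding clifford_vec_add clifford_vec_mult_self clifford_scalar_central_vec clifford_vec_scaleR ..
  finally show ?thesis
    using closed clifford_vec_closed [of \<epsilon> ?y] by (simp add: Cl.add.right_cancel)
qed

end

text \<open>
  By linearity the dependent vector can be replaced by one of the other two, and then two equal
  adjacent factors combine to a scalar, or the word is a palindrome.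
\<close>

lemma clifford_vec_reverse:
  fixes u v w :: "real ^ 'n::finite"
  assumes "w \<in> span {u, v} \<or> v \<in> span {u, w}"
  shows "clifford_vec \<epsilon> u \<otimes>\<^bsub>clifford_algebra \<epsilon>\<^esub> clifford_vec \<epsilon> v \<otimes>\<^bsub>clifford_algebra \<epsilon>\<^esub> clifford_vec \<epsilon> w
       = clifford_vec \<epsilon> w \<otimes>\<^bsub>clifford_algebra \<epsilon>\<^esub> clifford_vec \<epsilon> v \<otimes>\<^bsub>clifford_algebra \<epsilon>\<^esub> clifford_vec \<epsilon> u"
proof -
  let ?C = "clifford_algebra \<epsilon> :: ('n list \<Rightarrow> real) set ring"
  interpret Cl: ring ?C by (rule ring_clifford)
  let ?i = "clifford_vec \<epsilon> :: real ^ 'n \<Rightarrow> _" and ?s = "clifford_scalar \<epsilon> :: real \<Rightarrow> ('n list \<Rightarrow> real) set"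
  have combination: "\<exists>a b. x = a *\<^sub>R p + b *\<^sub>R q" if x: "x \<in> span {p, q}" for x p q :: "real ^ 'n"
  proof -
    obtain a where "x - a *\<^sub>R p \<in> span {q}" using x by (auto simp: span_insert)
    then obtain b where "x - a *\<^sub>R p = b *\<^sub>R q" by (auto simp: span_singleton)
    then have "x = a *\<^sub>R p + b *\<^sub>R q" by (simp add: algebra_simps)
    then show ?thesis by blast
  qed
  note closed = clifford_vec_closed clifford_scalar_closed
  have central: "?i p \<otimes>\<^bsub>?C\<^esub> (?s c \<otimes>\<^bsub>?C\<^esub> x) = ?s c \<otimes>\<^bsub>?C\<^esub> (?i p \<otimes>\<^bsub>?C\<^esub> x)"
    if "x \<in> carrier ?C" for p c x
    using clifford_scalar_central_vec [of \<epsilon> p c] that closed by (metis Cl.m_assoc)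
  have square: "?i p \<otimes>\<^bsub>?C\<^esub> (?i p \<otimes>\<^bsub>?C\<^esub> x) = ?s (\<epsilon> * (norm p)\<^sup>2) \<otimes>\<^bsub>?C\<^esub> x"
    if "x \<in> carrier ?C" for p x
    using clifford_vec_mult_self [of \<epsilon> p] that closed by (metis Cl.m_assoc)
  note rules = Cl.l_distr Cl.r_distr Cl.m_assoc closed clifford_vec_add clifford_vec_scaleR
    clifford_scalar_central_vec central square clifford_vec_mult_self
  show ?thesis
    using assms
  proof
    assume "w \<in> span {u, v}"
    then obtain a b where "w = a *\<^sub>R u + b *\<^sub>R v" using combination by blast
    then show ?thesis by (simp add: rules)
  next
    assume "v \<in> span {u, w}"
    then obtain a b where "v = a *\<^sub>R u + b *\<^sub>R w" using combination by blast
    then show ?thesis by (simp add: rules)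
  qed
qed

lemma dependent_in_plane:
  fixes u v w :: "real ^ 'n::finite"
  assumes "CARD('n) \<le> 2" and "u \<noteq> 0"
  shows "w \<in> span {u, v} \<or> v \<in> span {u, w}"
proof (cases "v \<in> span {u}")
  case True
  then have "v \<in> span {u, w}" using span_mono [of "{u}" "{u, w}"] by blast
  then show ?thesis ..
next
  case False
  then have "u \<noteq> v" by (auto simp: span_base)
  have "independent {v, u}" using False assms(2) by (subst independent_insert) auto
  moreover have "dim (UNIV :: (real ^ 'n) set) \<le> card {v, u}" using \<open>u \<noteq> v\<close> assms(1) by (simp add: dim_UNIV)
  ultimately have "UNIV \<subseteq> span {v, u}" by (intro card_ge_dim_independent) auto
  then show ?thesis by (auto simp: insert_commute)
qed

text \<open>
  A real number is determined by the rationals below it, so a function on a countable type is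
  determined by a set of pairs from a countable type.
\<close>

lemma countable_functions_lepoll_reals:
  "(UNIV :: ('a::countable \<Rightarrow> real) set) \<lesssim> (UNIV :: real set)"
proof -
  define cuts where "cuts f = to_nat ` {(a :: 'a, q :: rat). real_of_rat q < f a}" for f :: "'a \<Rightarrow> real"
  have "inj cuts"
  proof (rule injI, rule ext, rule ccontr)
    fix f g :: "'a \<Rightarrow> real" and a
    assume "cuts f = cuts g"
    then have "{(a, q). real_of_rat q < f a} = {(a, q). real_of_rat q < g a}"
      unfolding cuts_def by (simp add: inj_image_eq_iff)
    then have same: "real_of_rat q < f a \<longleftrightarrow> real_of_rat q < g a" for q by auto
    assume "f a \<noteq> g a"
    then consider "f a < g a" | "g a < f a" by linarith
    then show False
      \<comment> \<open>A rational between the two values satisfies only one of the two cut conditions.\<close>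
      using of_rat_dense [of "f a" "g a"] of_rat_dense [of "g a" "f a"] same
      by cases (meson order_less_asym order_less_le_trans less_imp_le not_less)+
  qed
  then have "(UNIV :: ('a \<Rightarrow> real) set) \<lesssim> (UNIV :: nat set set)"
    unfolding lepoll_def by blast
  then show ?thesis using nat_sets_eqpoll_reals lepoll_trans2 by blast
qed

lemma clifford_algebra_lepoll_reals:
  "carrier (clifford_algebra \<epsilon> :: ('n::finite list \<Rightarrow> real) set ring) \<lesssim> (UNIV :: real set)"
proof -
  have "carrier (clifford_algebra \<epsilon> :: ('n list \<Rightarrow> real) set ring)
      = (+>\<^bsub>tensor_algebra\<^esub>) (clifford_ideal \<epsilon>) ` carrier tensor_algebra"
    by (auto simp: clifford_algebra_def FactRing_def A_RCOSETS_def')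
  also have "\<dots> \<lesssim> (carrier tensor_algebra :: ('n list \<Rightarrow> real) set)"
    by (rule image_lepoll)
  also have "\<dots> \<lesssim> (UNIV :: ('n list \<Rightarrow> real) set)" by (rule subset_imp_lepoll) simp
  also have "\<dots> \<lesssim> (UNIV :: real set)" by (rule countable_functions_lepoll_reals)
  finally show ?thesis .
qed


section \<open>The Pin groups and their naturality\<close>

abbreviation unit_clifford_vecs :: "real \<Rightarrow> ('n::finite list \<Rightarrow> real) set set" where
  "unit_clifford_vecs \<epsilon> \<equiv> {clifford_vec \<epsilon> v | v :: real ^ 'n. norm v = 1}"

lemma pin_mult: "x \<otimes>\<^bsub>pin_group \<epsilon>\<^esub> y = x \<otimes>\<^bsub>clifford_algebra \<epsilon>\<^esub> y"
  by (simp add: pin_group_def units_of_mult)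

lemma pin_one: "\<one>\<^bsub>pin_group \<epsilon>\<^esub> = clifford_scalar \<epsilon> 1"
  by (simp add: pin_group_def units_of_one clifford_scalar_one)

context
  fixes \<epsilon> :: real
  assumes \<epsilon>: "\<epsilon> = 1 \<or> \<epsilon> = - 1"
begin

lemma pin_generated:
  "unit_clifford_vecs \<epsilon> \<subseteq> carrier (pin_group \<epsilon> :: ('n::finite list \<Rightarrow> real) set monoid)"
  "carrier (pin_group \<epsilon> :: ('n list \<Rightarrow> real) set monoid)
     = generate (pin_group \<epsilon>) (unit_clifford_vecs \<epsilon>)"
proof -
  let ?U = "units_of (clifford_algebra \<epsilon> :: ('n list \<Rightarrow> real) set ring)"
  let ?V = "unit_clifford_vecs \<epsilon> :: ('n list \<Rightarrow> real) set set"
  interpret U: group ?U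
    by (rule monoid.units_group [OF ring.is_monoid [OF ring_clifford]])
  have V: "?V \<subseteq> carrier ?U" by (auto simp: units_of_carrier intro: clifford_vec_Units [OF \<epsilon>])
  have sub: "?V \<subseteq> generate ?U ?V" by (auto intro: generate.incl)
  then show "?V \<subseteq> carrier (pin_group \<epsilon>)" by (simp add: pin_group_def)
  show "carrier (pin_group \<epsilon>) = generate (pin_group \<epsilon>) ?V"
    using U.generate_consistent [OF sub U.generate_is_subgroup [OF V]] by (simp add: pin_group_def)
qed

lemma unit_vec_in_pin:
  "norm v = 1 \<Longrightarrow> clifford_vec \<epsilon> v \<in> carrier (pin_group \<epsilon>)"
  using pin_generated(1) by blast

lemma unit_vec_square_pin:
  "norm v = 1 \<Longrightarrow> clifford_vec \<epsilon> v \<otimes>\<^bsub>pin_group \<epsilon>\<^esub> clifford_vec \<epsilon> v = clifford_scalar \<epsilon> \<epsilon>"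
  by (simp add: pin_mult clifford_vec_mult_self)

lemma pin_lepoll_reals:
  "carrier (pin_group \<epsilon> :: ('n::finite list \<Rightarrow> real) set monoid) \<lesssim> (UNIV :: real set)"
proof -
  let ?C = "clifford_algebra \<epsilon> :: ('n list \<Rightarrow> real) set ring"
  interpret U: group "units_of ?C"
    by (rule monoid.units_group [OF ring.is_monoid [OF ring_clifford]])
  have "unit_clifford_vecs \<epsilon> \<subseteq> carrier (units_of ?C)"
    by (auto simp: units_of_carrier intro: clifford_vec_Units [OF \<epsilon>])
  then have "carrier (pin_group \<epsilon>) \<subseteq> carrier (units_of ?C)"
    using U.generate_incl by (simp add: pin_group_def)
  also have "\<dots> \<subseteq> carrier ?C" by (auto simp: units_of_carrier Units_def)
  finally show ?thesis
    using clifford_algebra_lepoll_reals lepoll_trans subset_imp_lepoll by blast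
qed

lemma scalar_central_pin:
  assumes "g \<in> carrier (pin_group \<epsilon> :: ('n::finite list \<Rightarrow> real) set monoid)"
    and "clifford_scalar \<epsilon> c \<in> carrier (pin_group \<epsilon> :: ('n list \<Rightarrow> real) set monoid)"
  shows "g \<otimes>\<^bsub>pin_group \<epsilon>\<^esub> clifford_scalar \<epsilon> c = clifford_scalar \<epsilon> c \<otimes>\<^bsub>pin_group \<epsilon>\<^esub> g"
proof -
  interpret P: group "pin_group \<epsilon> :: ('n list \<Rightarrow> real) set monoid" by (rule group_pin_group [OF \<epsilon>])
  have "clifford_scalar \<epsilon> c \<otimes>\<^bsub>pin_group \<epsilon>\<^esub> v = v \<otimes>\<^bsub>pin_group \<epsilon>\<^esub> clifford_scalar \<epsilon> c"
    if "v \<in> unit_clifford_vecs \<epsilon>" for v :: "('n list \<Rightarrow> real) set"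
    using that by (auto simp: pin_mult clifford_scalar_central_vec)
  then show ?thesis
    using P.commutes_with_generated [OF pin_generated(1) assms(2), of g] assms(1) pin_generated(2)
    by auto
qed

end

theorem natural_pin_plus:
  "natural_group (pin_group 1 :: ('n::finite list \<Rightarrow> real) set monoid)"
proof -
  interpret P: group "pin_group 1 :: ('n list \<Rightarrow> real) set monoid"
    by (rule group_pin_group) simp
  show ?thesis
  proof (rule P.natural_if_ratio_preserving_trivial)
    show "carrier (pin_group 1 :: ('n list \<Rightarrow> real) set monoid) \<lesssim> (UNIV :: real set)"
      by (rule pin_lepoll_reals) simp
    have "v \<otimes>\<^bsub>pin_group 1\<^esub> v = \<one>\<^bsub>pin_group 1\<^esub>"
      if "v \<in> unit_clifford_vecs 1" for v :: "('n list \<Rightarrow> real) set"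
      using that by (auto simp: unit_vec_square_pin pin_one)
    then show "f x = x"
      if "P.ratio_preserving f" "x \<in> carrier (pin_group 1)" for f and x :: "('n list \<Rightarrow> real) set"
      using P.ratio_preserving_trivial_if_generated_by_involutions [OF pin_generated] that by simp
  qed
qed

text \<open>
  Turns the value of \<open>u x u\<close> into a rule for moving \<open>u\<close> to the right, since \<open>u\<inverse> = z u\<close>.
\<close>

lemma (in group) conjugate_by_square_root:
  assumes car: "u \<in> carrier G" "x \<in> carrier G" "z \<in> carrier G"
    and z: "z \<otimes> z = \<one>" "\<And>g. g \<in> carrier G \<Longrightarrow> g \<otimes> z = z \<otimes> g"
    and u: "u \<otimes> u = z" and uxu: "u \<otimes> x \<otimes> u = x'"
  shows "u \<otimes> x = z \<otimes> (x' \<otimes> u)"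
proof -
  have "x' \<otimes> u = u \<otimes> x \<otimes> (u \<otimes> u)" using car by (simp add: uxu [symmetric] m_assoc)
  also have "\<dots> = z \<otimes> (u \<otimes> x)" using u z(2) car by simp
  finally have "z \<otimes> (x' \<otimes> u) = (z \<otimes> z) \<otimes> (u \<otimes> x)" using car by (simp add: m_assoc)
  then show ?thesis using z(1) car by simp
qed

lemma pin_minus_reflection:
  assumes "norm a = 1"
  shows "clifford_vec (- 1) a \<otimes>\<^bsub>pin_group (- 1)\<^esub> clifford_vec (- 1) x
      \<otimes>\<^bsub>pin_group (- 1)\<^esub> clifford_vec (- 1) a
    = clifford_vec (- 1) (x - (2 * (a \<bullet> x)) *\<^sub>R a)"
  using assms by (simp add: pin_mult clifford_reflection)

lemma minus_one_pin_minus: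
  fixes z :: "('n::finite list \<Rightarrow> real) set"
  defines "z \<equiv> clifford_scalar (- 1) (- 1)"
  shows "z \<in> carrier (pin_group (- 1))" "z \<noteq> \<one>\<^bsub>pin_group (- 1)\<^esub>"
    "z \<otimes>\<^bsub>pin_group (- 1)\<^esub> z = \<one>\<^bsub>pin_group (- 1)\<^esub>"
    "g \<in> carrier (pin_group (- 1)) \<Longrightarrow>
       g \<otimes>\<^bsub>pin_group (- 1)\<^esub> z = z \<otimes>\<^bsub>pin_group (- 1)\<^esub> g"
proof -
  interpret P: group "pin_group (- 1) :: ('n list \<Rightarrow> real) set monoid"
    by (rule group_pin_group) simp
  have "norm (axis undefined 1 :: real ^ 'n) = 1" by simp
  note e = unit_vec_in_pin [OF _ this, of "- 1"] unit_vec_square_pin [OF _ this, of "- 1"]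
  show z: "z \<in> carrier (pin_group (- 1))"
    unfolding z_def using e P.m_closed by fastforce
  show "z \<noteq> \<one>\<^bsub>pin_group (- 1)\<^esub>"
    unfolding z_def pin_one using clifford_scalar_inj [of "- 1" "- 1" 1] by auto
  show "z \<otimes>\<^bsub>pin_group (- 1)\<^esub> z = \<one>\<^bsub>pin_group (- 1)\<^esub>"
    by (simp add: z_def pin_mult pin_one clifford_scalar_times)
  show "g \<in> carrier (pin_group (- 1)) \<Longrightarrow>
       g \<otimes>\<^bsub>pin_group (- 1)\<^esub> z = z \<otimes>\<^bsub>pin_group (- 1)\<^esub> g"
    using scalar_central_pin [of "- 1" g "- 1"] z by (simp add: z_def)
qed

text \<open>
  The unit vectors \<open>u\<close> and \<open>v\<close> below are normal to the mirrors that exchange \<open>a\<close> with \<open>b\<close> and \<open>b\<close> with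
  \<open>c\<close>. The product of the two reflections permutes \<open>a, b, c\<close> cyclically and has order three, and its
  lift \<open>y = u v\<close> satisfies \<open>y\<^sup>3 = (u v u) (v u v) = (u + v)\<^sup>2 = -1\<close>, since each of \<open>u\<close> and \<open>v\<close>
  reflects the other to \<open>u + v\<close>.
\<close>

theorem natural_pin_minus:
  assumes "CARD('n::finite) \<ge> 3"
  shows "natural_group (pin_group (- 1) :: ('n list \<Rightarrow> real) set monoid)"
proof -
  let ?P = "pin_group (- 1) :: ('n list \<Rightarrow> real) set monoid"
  interpret P: group ?P by (rule group_pin_group) simp
  let ?i = "clifford_vec (- 1) :: real ^ 'n \<Rightarrow> ('n list \<Rightarrow> real) set"
  define z :: "('n list \<Rightarrow> real) set" where "z = clifford_scalar (- 1) (- 1)"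
  note z = minus_one_pin_minus [where 'n = 'n, folded z_def]
  obtain i j k :: 'n where ijk: "i \<noteq> j" "j \<noteq> k" "i \<noteq> k"
  proof -
    obtain T :: "'n set" where "card T = 3" using assms by (metis obtain_subset_with_card_n)
    then show thesis using that by (auto simp: card_3_iff)
  qed
  define a b c :: "real ^ 'n" where "a = axis i 1" and "b = axis j 1" and "c = axis k 1"
  have inner: "a \<bullet> a = 1" "b \<bullet> b = 1" "c \<bullet> c = 1" "a \<bullet> b = 0" "b \<bullet> c = 0" "a \<bullet> c = 0"
    "b \<bullet> a = 0" "c \<bullet> b = 0" "c \<bullet> a = 0"
    using ijk by (simp_all add: a_def b_def c_def inner_axis_axis)
  define r :: real where "r = 1 / sqrt 2"
  have r: "r * r = 1 / 2" "2 * r * r = 1" by (simp_all add: r_def)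
  define u v where "u = r *\<^sub>R (a - b)" and "v = r *\<^sub>R (b - c)"
  have uv: "u \<bullet> u = 1" "v \<bullet> v = 1" "u \<bullet> v = - 1 / 2" "v \<bullet> u = - 1 / 2"
    "u \<bullet> a = r" "u \<bullet> b = - r" "u \<bullet> c = 0" "v \<bullet> a = 0" "v \<bullet> b = r" "v \<bullet> c = - r"
    using inner r(1) by (simp_all add: u_def v_def inner_simps mult.assoc [symmetric])
  have unit: "norm x = 1" if "x \<bullet> x = 1" for x :: "real ^ 'n"
    using that by (simp add: norm_eq_sqrt_inner)
  have closed: "?i x \<in> carrier ?P" if "x \<bullet> x = 1" for x
    using unit_vec_in_pin [of "- 1" x] unit [OF that] by simp
  have square: "?i x \<otimes>\<^bsub>?P\<^esub> ?i x = z" if "x \<bullet> x = 1" for x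
    using unit_vec_square_pin [of "- 1" x] unit [OF that] by (simp add: z_def)
  have refl: "?i x \<otimes>\<^bsub>?P\<^esub> ?i w = z \<otimes>\<^bsub>?P\<^esub> (?i w' \<otimes>\<^bsub>?P\<^esub> ?i x)"
    if x: "x \<bullet> x = 1" and w: "w \<bullet> w = 1" and w': "w - (2 * (x \<bullet> w)) *\<^sub>R x = w'" for x w w'
    using P.conjugate_by_square_root [OF closed [OF x] closed [OF w] z(1,3,4) square [OF x]]
      pin_minus_reflection [OF unit [OF x], of w] w' by simp
  have rr: "(2 * r) *\<^sub>R u = a - b" "(2 * r) *\<^sub>R v = b - c"
    by (simp_all only: u_def v_def scaleR_scaleR r(2) scaleR_one)
  define y where "y = ?i u \<otimes>\<^bsub>?P\<^esub> ?i v"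
  note car = closed [OF inner(1)] closed [OF inner(2)] closed [OF inner(3)]
    closed [OF uv(1)] closed [OF uv(2)]
  have zz: "z \<otimes>\<^bsub>?P\<^esub> (z \<otimes>\<^bsub>?P\<^esub> g) = g" if "g \<in> carrier ?P" for g
    using P.mult_left_extend [OF z(3) z(1) z(1) that] that by simp
  have zu: "?i u \<otimes>\<^bsub>?P\<^esub> (z \<otimes>\<^bsub>?P\<^esub> g) = z \<otimes>\<^bsub>?P\<^esub> (?i u \<otimes>\<^bsub>?P\<^esub> g)" if "g \<in> carrier ?P" for g
    using P.mult_left_extend [OF z(4) [OF car(4)] car(4) z(1) that] that car z(1)
    by (simp add: P.m_assoc)
  have cyclic: "y \<otimes>\<^bsub>?P\<^esub> ?i w = ?i w'' \<otimes>\<^bsub>?P\<^esub> y"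
    if "w \<bullet> w = 1" "w' \<bullet> w' = 1" "w'' \<bullet> w'' = 1"
      and "w - (2 * (v \<bullet> w)) *\<^sub>R v = w'" "w' - (2 * (u \<bullet> w')) *\<^sub>R u = w''" for w w' w''
  proof -
    note c = closed [OF that(1)] closed [OF that(2)] closed [OF that(3)]
    have "y \<otimes>\<^bsub>?P\<^esub> ?i w = ?i u \<otimes>\<^bsub>?P\<^esub> (z \<otimes>\<^bsub>?P\<^esub> (?i w' \<otimes>\<^bsub>?P\<^esub> ?i v))"
      using refl [OF uv(2) that(1,4)] c car by (simp add: y_def P.m_assoc)
    also have "\<dots> = z \<otimes>\<^bsub>?P\<^esub> ((?i u \<otimes>\<^bsub>?P\<^esub> ?i w') \<otimes>\<^bsub>?P\<^esub> ?i v)"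
      using c car zu by (simp add: P.m_assoc)
    also have "\<dots> = z \<otimes>\<^bsub>?P\<^esub> (z \<otimes>\<^bsub>?P\<^esub> (?i w'' \<otimes>\<^bsub>?P\<^esub> ?i u) \<otimes>\<^bsub>?P\<^esub> ?i v)"
      using refl [OF uv(1) that(2,5)] by simp
    also have "\<dots> = ?i w'' \<otimes>\<^bsub>?P\<^esub> y"
      using c car z(1) zz by (simp add: y_def P.m_assoc)
    finally show ?thesis .
  qed
  have cube: "y \<otimes>\<^bsub>?P\<^esub> y \<otimes>\<^bsub>?P\<^esub> y = z"
  proof -
    have "y \<otimes>\<^bsub>?P\<^esub> y \<otimes>\<^bsub>?P\<^esub> y
        = (?i u \<otimes>\<^bsub>?P\<^esub> ?i v \<otimes>\<^bsub>?P\<^esub> ?i u) \<otimes>\<^bsub>?P\<^esub> (?i v \<otimes>\<^bsub>?P\<^esub> ?i u \<otimes>\<^bsub>?P\<^esub> ?i v)"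
      using car by (simp add: y_def P.m_assoc)
    also have "\<dots> = ?i (u + v) \<otimes>\<^bsub>?P\<^esub> ?i (u + v)"
      using unit uv by (simp add: pin_minus_reflection add.commute)
    also have "\<dots> = z" by (rule square) (simp add: inner_simps uv)
    finally show ?thesis .
  qed
  show ?thesis
  proof (rule P.natural_if_ratio_preserving_trivial)
    show "carrier ?P \<lesssim> (UNIV :: real set)" by (rule pin_lepoll_reals) simp
    fix f x assume f: "P.ratio_preserving f" and x: "x \<in> carrier ?P"
    show "f x = x"
    proof (rule P.ratio_preserving_trivial_if_cyclic_triple [OF f car(1-3) _ z(1-3)])
      show "y \<in> carrier ?P" using car by (simp add: y_def)
      show "y \<otimes>\<^bsub>?P\<^esub> ?i a = ?i b \<otimes>\<^bsub>?P\<^esub> y"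
        using cyclic [of a a b] inner uv rr by simp
      show "y \<otimes>\<^bsub>?P\<^esub> ?i b = ?i c \<otimes>\<^bsub>?P\<^esub> y"
        using cyclic [of b c c] inner uv rr by simp
      show "?i b \<otimes>\<^bsub>?P\<^esub> ?i a = z \<otimes>\<^bsub>?P\<^esub> (?i a \<otimes>\<^bsub>?P\<^esub> ?i b)"
        "?i c \<otimes>\<^bsub>?P\<^esub> ?i b = z \<otimes>\<^bsub>?P\<^esub> (?i b \<otimes>\<^bsub>?P\<^esub> ?i c)"
        "?i c \<otimes>\<^bsub>?P\<^esub> ?i a = z \<otimes>\<^bsub>?P\<^esub> (?i a \<otimes>\<^bsub>?P\<^esub> ?i c)"
        by (rule refl; simp add: inner)+
      show "g \<otimes>\<^bsub>?P\<^esub> z = z \<otimes>\<^bsub>?P\<^esub> g" if "g \<in> carrier ?P" for g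
        using that by (rule z(4))
    qed (use cube x square inner in auto)
  qed
qed

theorem not_natural_pin_minus:
  assumes "CARD('n::finite) \<le> 2"
  shows "\<not> natural_group (pin_group (- 1) :: ('n list \<Rightarrow> real) set monoid)"
proof -
  interpret P: group "pin_group (- 1) :: ('n list \<Rightarrow> real) set monoid"
    by (rule group_pin_group) simp
  have gen: "unit_clifford_vecs (- 1) \<subseteq> carrier (pin_group (- 1) :: ('n list \<Rightarrow> real) set monoid)"
    "carrier (pin_group (- 1) :: ('n list \<Rightarrow> real) set monoid)
      = generate (pin_group (- 1)) (unit_clifford_vecs (- 1))"
    by (rule pin_generated; simp)+
  show ?thesis
  proof (rule P.not_natural_if_generators_reverse [OF gen(1) _ gen(2) minus_one_pin_minus(2,3)])
    have "norm (axis undefined 1 :: real ^ 'n) = 1" by simp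
    then show "(unit_clifford_vecs (- 1) :: ('n list \<Rightarrow> real) set set) \<noteq> {}" by blast
    show "v \<otimes>\<^bsub>pin_group (- 1)\<^esub> v = clifford_scalar (- 1) (- 1)"
      if "v \<in> unit_clifford_vecs (- 1)" for v :: "('n list \<Rightarrow> real) set"
      using that by (auto simp: unit_vec_square_pin)
    show "u \<otimes>\<^bsub>pin_group (- 1)\<^esub> v \<otimes>\<^bsub>pin_group (- 1)\<^esub> w
        = w \<otimes>\<^bsub>pin_group (- 1)\<^esub> v \<otimes>\<^bsub>pin_group (- 1)\<^esub> u"
      if uvw: "u \<in> unit_clifford_vecs (- 1)" "v \<in> unit_clifford_vecs (- 1)"
        "w \<in> unit_clifford_vecs (- 1)" for u v w :: "('n list \<Rightarrow> real) set"
    proof -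
      obtain p q r :: "real ^ 'n" where "u = clifford_vec (- 1) p" "norm p = 1"
        "v = clifford_vec (- 1) q" "w = clifford_vec (- 1) r"
        using uvw by blast
      moreover from \<open>norm p = 1\<close> have "p \<noteq> 0" by auto
      ultimately show ?thesis
        using clifford_vec_reverse [OF dependent_in_plane [OF assms]] by (simp add: pin_mult)
    qed
  qed
qed


theorem theorem11:
  shows "natural_group (Pin_plus TYPE('n::finite)) \<and>
         (natural_group (Pin_minus TYPE('n)) \<longleftrightarrow> CARD('n) \<ge> 3)"
proof (intro conjI iffI)
  show "natural_group (Pin_plus TYPE('n))"
    unfolding Pin_plus_def by (rule natural_pin_plus)
  show "CARD('n) \<ge> 3" if "natural_group (Pin_minus TYPE('n))"
    using that not_natural_pin_minus [where 'n = 'n] unfolding Pin_minus_def by fastforce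
  show "natural_group (Pin_minus TYPE('n))" if "CARD('n) \<ge> 3"
    unfolding Pin_minus_def by (rule natural_pin_minus [OF that])
qed

end
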